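(* Let $M=\{p_1,p_2,p_3,p_4\}$, and let $\rho$ be an arbitrary pseudo-metric on $M$. Put $\rho_{ij}=\rho(p_i,p_j)$. Then the weight of a minimal filling $\mathcal G=(G,\omega)$ of the space $\mathcal M=(M,\rho)$ is given by the formula $$\frac12\Bigl(\min\{\rho_{12}+\rho_{34},\,\rho_{13}+\rho_{24},\,\rho_{14}+\rho_{23}\}+\max\{\rho_{12}+\rho_{34},\,\rho_{13}+\rho_{24},\,\rho_{14}+\rho_{23}\}\Bigr).$$ If the minimum in this formula is equal to $\rho_{ij}+\rho_{rs}$ (where $\{i,j,r,s\}=\{1,2,3,4\}$), then the type of minimal filling is the binary tree with the mustaches $\{p_i,p_j\}$ and $\{p_r,p_s\}$.
   Context: In a pseudo-metric space the distance between distinct points may be $0$. A finite graph $G=(V,E)$ joins $M$ if it is connected and $M\subset V$. For a weight function $\omega:E\to[0,\infty)$, $d_\omega(u,v)$ is the least weight (sum of $\omega$ over edges) of a path in $G$ joining $u$ and $v$, and $\omega(G)=\sum_{e\in E}\omega(e)$. The weighted graph $(G,\omega)$ is a filling of $(M,\rho)$ if $G$ joins $M$ and $\rho(p,q)\le d_\omega(p,q)$ for all $p,q\in M$; the graph $G$ is called the type of this filling. A minimal filling is a filling whose weight $\omega(G)$ is least among all fillings of $(M,\rho)$ (over all connected graphs $G$ joining $M$). Convention: the minimal fillings considered are those whose types are trees all of whose vertices of degree $1$ and $2$ belong to $M$; edges of weight $0$ are allowed. The binary tree with mustaches $\{p_i,p_j\}$ and $\{p_r,p_s\}$ is the tree with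 vertex set $M\cup\{v,w\}$ ($v,w\notin M$ distinct) and edges $vp_i,\ vp_j,\ vw,\ wp_r,\ wp_s$. *)

theory Defs
  imports Complex_Main "HOL-Library.Infinite_Typeclass"
begin

text \<open>A simple undirected graph is a pair of a vertex set and a set of edges, an edge being
  a two-element set of vertices.\<close>

type_synonym 'a graph = "'a set \<times> 'a set set"

abbreviation verts :: "'a graph \<Rightarrow> 'a set" where "verts G \<equiv> fst G"
abbreviation edges :: "'a graph \<Rightarrow> 'a set set" where "edges G \<equiv> snd G"

definition finite_graph :: "'a graph \<Rightarrow> bool" where
  "finite_graph G \<longleftrightarrow> finite (verts G) \<and> (\<forall>e\<in>edges G. e \<subseteq> verts G \<and> card e = 2)"

definition degree :: "'a graph \<Rightarrow> 'a \<Rightarrow> nat" where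
  "degree G v = card {e \<in> edges G. v \<in> e}"

text \<open>Paths are lists of pairwise distinct vertices; the one-vertex path joins a vertex
  to itself.\<close>

definition is_path :: "'a graph \<Rightarrow> 'a \<Rightarrow> 'a list \<Rightarrow> 'a \<Rightarrow> bool" where
  "is_path G u xs v \<longleftrightarrow>
     xs \<noteq> [] \<and> hd xs = u \<and> last xs = v \<and> distinct xs \<and> set xs \<subseteq> verts G \<and>
     successively (\<lambda>x y. {x, y} \<in> edges G) xs"

definition path_weight :: "('a set \<Rightarrow> real) \<Rightarrow> 'a list \<Rightarrow> real" where
  "path_weight \<omega> xs = (\<Sum>(x, y)\<leftarrow>zip xs (tl xs). \<omega> {x, y})"

definition connected_graph :: "'a graph \<Rightarrow> bool" where
  "connected_graph G \<longleftrightarrow> (\<forall>u\<in>verts G. \<forall>v\<in>verts G. \<exists>xs. is_path G u xs v)"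

definition is_cycle :: "'a graph \<Rightarrow> 'a list \<Rightarrow> bool" where
  "is_cycle G xs \<longleftrightarrow>
     length xs \<ge> 3 \<and> distinct xs \<and> successively (\<lambda>x y. {x, y} \<in> edges G) xs \<and>
     {last xs, hd xs} \<in> edges G"

definition is_tree :: "'a graph \<Rightarrow> bool" where
  "is_tree G \<longleftrightarrow> finite_graph G \<and> connected_graph G \<and> (\<nexists>xs. is_cycle G xs)"

definition joins :: "'a graph \<Rightarrow> 'a set \<Rightarrow> bool" where
  "joins G M \<longleftrightarrow> finite_graph G \<and> connected_graph G \<and> M \<subseteq> verts G"

text \<open>In a finite graph there are only finitely many paths from \<open>u\<close> to \<open>v\<close>, so the minimum
  below is a genuine one whenever \<open>u\<close> and \<open>v\<close> lie in the same component.\<close>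

definition graph_dist :: "'a graph \<Rightarrow> ('a set \<Rightarrow> real) \<Rightarrow> 'a \<Rightarrow> 'a \<Rightarrow> real" where
  "graph_dist G \<omega> u v = Min {path_weight \<omega> xs |xs. is_path G u xs v}"

definition graph_weight :: "'a graph \<Rightarrow> ('a set \<Rightarrow> real) \<Rightarrow> real" where
  "graph_weight G \<omega> = (\<Sum>e\<in>edges G. \<omega> e)"

definition pseudo_metric_on :: "'a set \<Rightarrow> ('a \<Rightarrow> 'a \<Rightarrow> real) \<Rightarrow> bool" where
  "pseudo_metric_on M \<rho> \<longleftrightarrow>
     (\<forall>x\<in>M. \<rho> x x = 0) \<and>
     (\<forall>x\<in>M. \<forall>y\<in>M. \<rho> x y \<ge> 0 \<and> \<rho> x y = \<rho> y x) \<and>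
     (\<forall>x\<in>M. \<forall>y\<in>M. \<forall>z\<in>M. \<rho> x z \<le> \<rho> x y + \<rho> y z)"

definition filling :: "'a set \<Rightarrow> ('a \<Rightarrow> 'a \<Rightarrow> real) \<Rightarrow> 'a graph \<Rightarrow> ('a set \<Rightarrow> real) \<Rightarrow> bool" where
  "filling M \<rho> G \<omega> \<longleftrightarrow>
     joins G M \<and> (\<forall>e\<in>edges G. \<omega> e \<ge> 0) \<and> (\<forall>x\<in>M. \<forall>y\<in>M. \<rho> x y \<le> graph_dist G \<omega> x y)"

text \<open>The competitors have their vertices in the type \<open>'a\<close>. As they are finite graphs, this is
  no restriction up to isomorphism once \<open>'a\<close> is infinite.\<close>

definition minimal_filling ::
    "'a::infinite set \<Rightarrow> ('a \<Rightarrow> 'a \<Rightarrow> real) \<Rightarrow> 'a graph \<Rightarrow> ('a set \<Rightarrow> real) \<Rightarrow> bool" where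
  "minimal_filling M \<rho> G \<omega> \<longleftrightarrow>
     filling M \<rho> G \<omega> \<and>
     (\<forall>H \<eta>. filling M \<rho> H \<eta> \<longrightarrow> graph_weight G \<omega> \<le> graph_weight H \<eta>)"

definition reduced_tree :: "'a set \<Rightarrow> 'a graph \<Rightarrow> bool" where
  "reduced_tree M G \<longleftrightarrow> is_tree G \<and> (\<forall>v\<in>verts G. degree G v \<in> {1, 2} \<longrightarrow> v \<in> M)"

definition mustache_tree :: "'a set \<Rightarrow> 'a \<Rightarrow> 'a \<Rightarrow> 'a \<Rightarrow> 'a \<Rightarrow> 'a graph \<Rightarrow> bool" where
  "mustache_tree M a b c d G \<longleftrightarrow>
     (\<exists>v w. v \<noteq> w \<and> v \<notin> M \<and> w \<notin> M \<and>
        G = (M \<union> {v, w}, {{v, a}, {v, b}, {v, w}, {w, c}, {w, d}}))"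

text \<open>The weighted tree \<open>(G, \<omega>)\<close> arises from the weighted tree \<open>(T, \<eta>)\<close> by contracting a set
  \<open>C\<close> of edges of weight zero: \<open>f\<close> identifies exactly the vertices joined by edges in \<open>C\<close>, fixes
  the points of \<open>M\<close>, and carries the remaining edges with their weights onto the edges of \<open>G\<close>.
  (In a tree no edge outside \<open>C\<close> becomes a loop or parallel to another edge.)\<close>

definition zero_contraction ::
    "'a set \<Rightarrow> 'a graph \<Rightarrow> ('a set \<Rightarrow> real) \<Rightarrow> 'a graph \<Rightarrow> ('a set \<Rightarrow> real) \<Rightarrow> bool" where
  "zero_contraction M T \<eta> G \<omega> \<longleftrightarrow>
     (\<exists>C f. C \<subseteq> {e \<in> edges T. \<eta> e = 0} \<and>
        f ` verts T = verts G \<and> (\<forall>x\<in>M. f x = x) \<and>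
        (\<forall>x\<in>verts T. \<forall>y\<in>verts T. f x = f y \<longleftrightarrow> (x, y) \<in> {(a, b). {a, b} \<in> C}\<^sup>*) \<and>
        bij_betw ((`) f) (edges T - C) (edges G) \<and>
        (\<forall>e\<in>edges T - C. \<omega> (f ` e) = \<eta> e))"

end

theory Submission
  imports Defs
begin

text \<open>Write \<open>A\<close>, \<open>B\<close>, \<open>C\<close> for the three sums of \<open>\<rho>\<close> over the perfect matchings of the four points.

  Lower bound (\<open>filling_weight_ge\<close>). The distance \<open>d\<close> of a filling is a pseudo-metric on all its
  vertices that is at most \<open>\<omega>\<close> on every edge. For such a \<open>d\<close> on a tree of total weight \<open>W\<close>, any
  four vertices satisfy \<open>min + max \<le> 2 W\<close>, where the minimum and the maximum run over the three
  matching sums of \<open>d\<close>. This is \<open>four_point_bound\<close>, proved by adding the vertices of the tree one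
  leaf at a time, the four vertices being allowed to coincide: pulling those that sit at the new
  leaf back to its neighbour lowers the left-hand side by at most twice the weight of the new
  edge. It applies to a spanning tree of the filling.

  Upper bound (\<open>optimal_mustache_filling\<close>). If the matching \<open>ab|ce\<close> attains the minimum, the
  mustache tree with that pairing carries explicit weights whose inner edge is half the difference
  between the maximum and the minimum. Hence a filling is minimal exactly if \<open>2 W = min + max\<close>
  (\<open>minimal_filling_iff\<close>).

  Types. A tree in which at most four vertices have degree 1 or 2 has one of finitely many shapes
  (\<open>tree_shapes\<close>): adding a leaf never lowers the number of such vertices, so the shapes can be
  grown one leaf at a time. If moreover these vertices lie in a set of four vertices, the tree
  arises from a mustache tree by contracting edges
  (\<open>reduced_tree_is_contracted_mustache\<close>). Giving the contracted edges weight zero turns a minimal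
  filling into a minimal filling whose type is the mustache tree (\<open>filling_edge_expansion\<close>). With
  inner edge of weight \<open>\<mu>\<close>, a mustache filling satisfies
  \<open>A \<le> W - \<mu>\<close>, \<open>B \<le> W + \<mu>\<close>, \<open>C \<le> W + \<mu>\<close> for the sum \<open>A\<close> of its own pairing; together with
  \<open>2 W = min + max\<close> this forces \<open>A\<close> to be the minimum (\<open>mustache_filling_min\<close>).\<close>

section \<open>The distance of a weighted graph\<close>

lemma path_weight_simps [simp]:
  "path_weight \<omega> [] = 0"
  "path_weight \<omega> [x] = 0"
  "path_weight \<omega> (x # y # xs) = \<omega> {x, y} + path_weight \<omega> (y # xs)"
  by (simp_all add: path_weight_def)

lemma path_weight_append:
  assumes "xs \<noteq> []" "ys \<noteq> []"
  shows "path_weight \<omega> (xs @ ys) =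
    path_weight \<omega> xs + \<omega> {last xs, hd ys} + path_weight \<omega> ys"
  using assms(1)
proof (induction xs rule: list_nonempty_induct)
  case (single x)
  then show ?case using assms(2) by (cases ys) auto
next
  case (cons x xs)
  then show ?case by (cases xs) auto
qed

lemma path_weight_rev: "path_weight \<omega> (rev xs) = path_weight \<omega> xs"
proof (induction xs)
  case (Cons x xs)
  show ?case
  proof (cases xs)
    case (Cons y ys)
    then have "path_weight \<omega> (rev xs @ [x]) = path_weight \<omega> (rev xs) + \<omega> {y, x}"
      by (subst path_weight_append) (auto simp: last_rev)
    then show ?thesis using Cons.IH Cons by (simp add: insert_commute)
  qed simp
qed simp

lemma path_weight_nonneg:
  assumes "\<forall>e\<in>edges G. \<omega> e \<ge> 0" "successively (\<lambda>x y. {x, y} \<in> edges G) xs"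
  shows "path_weight \<omega> xs \<ge> 0"
  using assms(2) by (induction xs rule: induct_list012) (use assms(1) in auto)

lemma path_weight_suffix_le:
  assumes "\<forall>e\<in>edges G. \<omega> e \<ge> 0" "successively (\<lambda>x y. {x, y} \<in> edges G) (us @ x # vs)"
  shows "path_weight \<omega> (x # vs) \<le> path_weight \<omega> (us @ x # vs)"
proof (cases "us = []")
  case False
  have "path_weight \<omega> us \<ge> 0"
    using assms by (intro path_weight_nonneg[of G]) (auto simp: successively_append_iff)
  moreover have "\<omega> {last us, x} \<ge> 0"
    using assms False by (auto simp: successively_append_iff)
  ultimately show ?thesis using False by (simp add: path_weight_append)
qed simp

lemma walk_contains_path:
  assumes "\<forall>e\<in>edges G. \<omega> e \<ge> 0" "xs \<noteq> []" "set xs \<subseteq> verts G"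
    "successively (\<lambda>x y. {x, y} \<in> edges G) xs"
  shows "\<exists>ys. is_path G (hd xs) ys (last xs) \<and> path_weight \<omega> ys \<le> path_weight \<omega> xs"
  using assms(2,3,4)
proof (induction xs rule: list_nonempty_induct)
  case (single x)
  then have "is_path G x [x] x" by (simp add: is_path_def)
  then show ?case by (intro exI[of _ "[x]"]) simp
next
  case (cons x xs)
  from cons obtain ys where ys: "is_path G (hd xs) ys (last xs)"
    and le: "path_weight \<omega> ys \<le> path_weight \<omega> xs"
    by (auto simp: successively_Cons)
  have e: "{x, hd xs} \<in> edges G" using cons by (auto simp: successively_Cons)
  have hd: "hd ys = hd xs" "ys \<noteq> []" using ys by (auto simp: is_path_def)
  have w: "path_weight \<omega> (x # xs) = \<omega> {x, hd xs} + path_weight \<omega> xs"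
    using cons.hyps by (cases xs) auto
  show ?case
  proof (cases "x \<in> set ys")
    case False
    then have "is_path G x (x # ys) (last xs)"
      using ys e cons.prems by (auto simp: is_path_def successively_Cons)
    moreover have "path_weight \<omega> (x # ys) = \<omega> {x, hd xs} + path_weight \<omega> ys"
      using hd by (cases ys) auto
    ultimately show ?thesis using le w cons.hyps by (intro exI[of _ "x # ys"]) auto
  next
    case True
    then obtain us vs where uv: "ys = us @ x # vs" by (meson split_list)
    then have "is_path G x (x # vs) (last xs)"
      using ys by (auto simp: is_path_def successively_append_iff)
    moreover have "path_weight \<omega> (x # vs) \<le> path_weight \<omega> ys"
      using path_weight_suffix_le[OF assms(1)] ys uv by (auto simp: is_path_def)
    moreover have "\<omega> {x, hd xs} \<ge> 0" using e assms(1) by auto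
    ultimately show ?thesis using le w cons.hyps by (intro exI[of _ "x # vs"]) auto
  qed
qed

lemma is_path_rev: "is_path G u xs v \<Longrightarrow> is_path G v (rev xs) u"
  by (auto simp: is_path_def hd_rev last_rev successively_rev insert_commute)

lemma finite_path_weights:
  assumes "finite_graph G"
  shows "finite {path_weight \<omega> xs |xs. is_path G u xs v}"
proof -
  have "{xs. is_path G u xs v} \<subseteq> {xs. set xs \<subseteq> verts G \<and> length xs \<le> card (verts G)}"
    using assms by (auto simp: is_path_def finite_graph_def)
      (metis card_mono distinct_card)
  moreover have "finite \<dots>"
    using assms finite_lists_length_le by (auto simp: finite_graph_def)
  ultimately have "finite {xs. is_path G u xs v}" by (rule finite_subset)
  then have "finite (path_weight \<omega> ` {xs. is_path G u xs v})" by simp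
  then show ?thesis by (simp add: image_Collect)
qed

lemma graph_dist_le:
  assumes "finite_graph G" "is_path G u xs v"
  shows "graph_dist G \<omega> u v \<le> path_weight \<omega> xs"
  unfolding graph_dist_def
  using finite_path_weights[OF assms(1)] assms(2) by (intro Min_le) auto

lemma graph_dist_attained:
  assumes "finite_graph G" "connected_graph G" "u \<in> verts G" "v \<in> verts G"
  obtains xs where "is_path G u xs v" "graph_dist G \<omega> u v = path_weight \<omega> xs"
proof -
  have "{path_weight \<omega> xs |xs. is_path G u xs v} \<noteq> {}"
    using assms(2-4) by (auto simp: connected_graph_def)
  then have "Min {path_weight \<omega> xs |xs. is_path G u xs v} \<in>
      {path_weight \<omega> xs |xs. is_path G u xs v}"
    using finite_path_weights[OF assms(1)] by (intro Min_in)
  then show ?thesis using that by (auto simp: graph_dist_def)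
qed

lemma graph_dist_edge_le:
  assumes "finite_graph G" "{x, y} \<in> edges G"
  shows "graph_dist G \<omega> x y \<le> \<omega> {x, y}"
proof -
  have "x \<noteq> y" "x \<in> verts G" "y \<in> verts G"
    using assms by (auto simp: finite_graph_def)
  then have "is_path G x [x, y] y" using assms by (auto simp: is_path_def)
  from graph_dist_le[OF assms(1) this] show ?thesis by simp
qed

lemma pseudo_metric_graph_dist:
  assumes G: "finite_graph G" "connected_graph G" and nn: "\<forall>e\<in>edges G. \<omega> e \<ge> 0"
  shows "pseudo_metric_on (verts G) (graph_dist G \<omega>)"
proof -
  let ?d = "graph_dist G \<omega>"
  have nonneg: "?d x y \<ge> 0" if xy: "x \<in> verts G" "y \<in> verts G" for x y
    using graph_dist_attained[OF G xy] path_weight_nonneg[OF nn]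
    by (metis is_path_def)
  have "?d x x = 0" if x: "x \<in> verts G" for x
  proof -
    have "is_path G x [x] x" using x by (simp add: is_path_def)
    from graph_dist_le[OF G(1) this, of \<omega>] nonneg[OF x x] show ?thesis by simp
  qed
  moreover have sym_le: "?d y x \<le> ?d x y" if xy: "x \<in> verts G" "y \<in> verts G" for x y
    using graph_dist_attained[OF G xy] graph_dist_le[OF G(1)] is_path_rev path_weight_rev
    by metis
  moreover have "?d x z \<le> ?d x y + ?d y z"
    if xyz: "x \<in> verts G" "y \<in> verts G" "z \<in> verts G" for x y z
  proof -
    obtain xs where xs: "is_path G x xs y" "?d x y = path_weight \<omega> xs"
      using graph_dist_attained[OF G xyz(1,2)] .
    obtain ys where ys: "is_path G y ys z" "?d y z = path_weight \<omega> ys"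
      using graph_dist_attained[OF G xyz(2,3)] .
    obtain zs where zs: "ys = y # zs" using ys(1) by (cases ys) (auto simp: is_path_def)
    let ?w = "xs @ zs"
    have w: "?w \<noteq> []" "set ?w \<subseteq> verts G" "hd ?w = x"
      using xs(1) ys(1) zs by (auto simp: is_path_def)
    have s: "successively (\<lambda>x y. {x, y} \<in> edges G) ?w"
      using xs(1) ys(1) zs by (cases zs) (simp_all add: is_path_def successively_append_iff)
    have "last ?w = z" using xs(1) ys(1) zs by (auto simp: is_path_def)
    moreover have "path_weight \<omega> ?w = path_weight \<omega> xs + path_weight \<omega> ys"
      using xs(1) zs by (cases zs) (auto simp: path_weight_append is_path_def)
    ultimately obtain zs where "is_path G x zs z"
        "path_weight \<omega> zs \<le> path_weight \<omega> xs + path_weight \<omega> ys"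
      using walk_contains_path[OF nn w(1,2) s] unfolding w(3) by auto
    then show ?thesis using graph_dist_le[OF G(1), of x zs z \<omega>] xs(2) ys(2) by simp
  qed
  moreover have "?d x y = ?d y x" if "x \<in> verts G" "y \<in> verts G" for x y
    using sym_le that by (simp add: antisym)
  ultimately show ?thesis using nonneg unfolding pseudo_metric_on_def by blast
qed

text \<open>A potential \<open>h\<close> whose increase along each edge, in either direction, is at most the weight
  bounds the weight of every path from below. Such potentials certify that a weighted graph is a
  filling without a survey of its paths.\<close>

lemma path_weight_ge_potential:
  assumes "\<And>x y. {x, y} \<in> edges G \<Longrightarrow> h y - h x \<le> \<omega> {x, y}"
    "successively (\<lambda>x y. {x, y} \<in> edges G) xs" "xs \<noteq> []"
  shows "h (last xs) - h (hd xs) \<le> path_weight \<omega> xs"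
  using assms(3,2)
proof (induction xs rule: list_nonempty_induct)
  case (cons x xs)
  then have "h (hd xs) - h x \<le> \<omega> {x, hd xs}"
    using assms(1) by (auto simp: successively_Cons)
  moreover have "path_weight \<omega> (x # xs) = \<omega> {x, hd xs} + path_weight \<omega> xs"
    using cons.hyps by (cases xs) auto
  ultimately show ?case using cons by (auto simp: successively_Cons)
qed simp

lemma filling_by_potentials:
  assumes J: "joins G M" and "\<forall>e\<in>edges G. \<omega> e \<ge> 0"
    and pot: "\<And>x y. x \<in> M \<Longrightarrow> y \<in> M \<Longrightarrow>
      \<exists>h. \<rho> x y \<le> h y - h x \<and> (\<forall>u v. {u, v} \<in> edges G \<longrightarrow> h v - h u \<le> \<omega> {u, v})"
  shows "filling M \<rho> G \<omega>"
proof -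
  have "\<rho> x y \<le> graph_dist G \<omega> x y" if xy: "x \<in> M" "y \<in> M" for x y
  proof -
    have v: "x \<in> verts G" "y \<in> verts G" using J xy by (auto simp: joins_def)
    obtain xs where xs: "is_path G x xs y" "graph_dist G \<omega> x y = path_weight \<omega> xs"
      using graph_dist_attained[OF _ _ v] J by (metis joins_def)
    obtain h where h: "\<rho> x y \<le> h y - h x"
        "\<And>u v. {u, v} \<in> edges G \<Longrightarrow> h v - h u \<le> \<omega> {u, v}"
      using pot[OF xy] by blast
    have "h y - h x \<le> path_weight \<omega> xs"
      using path_weight_ge_potential[of G h, OF h(2)] xs(1) by (auto simp: is_path_def)
    with h(1) xs(2) show ?thesis by simp
  qed
  with assms show ?thesis by (simp add: filling_def)
qed

section \<open>Trees grown leaf by leaf\<close>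

text \<open>Trees generated from one vertex by successively attaching a leaf \<open>x\<close> to an old vertex \<open>y\<close>.
  They serve both as spanning trees of connected graphs and as an induction principle for
  trees.\<close>

inductive grown_tree :: "'a set \<Rightarrow> 'a set set \<Rightarrow> bool" where
  single: "grown_tree {x} {}"
| add_leaf: "grown_tree V E \<Longrightarrow> y \<in> V \<Longrightarrow> x \<notin> V \<Longrightarrow> grown_tree (insert x V) (insert {x, y} E)"

lemma finite_graph_grown_tree: "grown_tree V E \<Longrightarrow> finite_graph (V, E)"
proof (induction rule: grown_tree.induct)
  case (add_leaf V E y x)
  then have "card {x, y} = 2" by (metis card_2_iff)
  with add_leaf show ?case by (auto simp: finite_graph_def)
qed (simp add: finite_graph_def)

lemma finite_edges: "finite_graph G \<Longrightarrow> finite (edges G)"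
  by (rule finite_subset[of _ "Pow (verts G)"]) (auto simp: finite_graph_def)

lemma is_path_mono:
  "is_path (V, E) u xs v \<Longrightarrow> V \<subseteq> V' \<Longrightarrow> E \<subseteq> E' \<Longrightarrow> is_path (V', E') u xs v"
  by (auto simp: is_path_def intro: successively_mono)

lemma connected_grown_tree: "grown_tree V E \<Longrightarrow> connected_graph (V, E)"
proof (induction rule: grown_tree.induct)
  case (single x)
  then show ?case by (auto simp: connected_graph_def is_path_def intro!: exI[of _ "[x]"])
next
  case (add_leaf V E y x)
  let ?G = "(insert x V, insert {x, y} E)"
  have old: "\<exists>xs. is_path ?G u xs v \<and> x \<notin> set xs" if "u \<in> V" "v \<in> V" for u v
  proof -
    obtain xs where "is_path (V, E) u xs v"
      using add_leaf.IH \<open>u \<in> V\<close> \<open>v \<in> V\<close> unfolding connected_graph_def by auto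
    moreover from this have "x \<notin> set xs" using add_leaf.hyps by (auto simp: is_path_def)
    ultimately show ?thesis using is_path_mono[of V E] by blast
  qed
  have new: "\<exists>xs. is_path ?G x xs v" if "v \<in> V" for v
  proof -
    obtain xs where xs: "is_path ?G y xs v" "x \<notin> set xs" using old add_leaf.hyps \<open>v \<in> V\<close> by blast
    then have "is_path ?G x (x # xs) v" by (auto simp: is_path_def successively_Cons)
    then show ?thesis by blast
  qed
  have "is_path ?G x [x] x" by (simp add: is_path_def)
  then have "\<exists>xs. is_path ?G u xs v" if "u \<in> insert x V" "v \<in> insert x V" for u v
    using that old[of u v] new[of v] new[of u] is_path_rev[of ?G x _ u] by blast
  then show ?case by (simp add: connected_graph_def)
qed

lemma crossing_edge:
  assumes "successively R xs" "xs \<noteq> []" "hd xs \<in> V" "last xs \<notin> V"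
  shows "\<exists>y x. R y x \<and> y \<in> V \<and> x \<notin> V \<and> x \<in> set xs"
  using assms(2,1,3,4)
proof (induction xs rule: list_nonempty_induct)
  case (cons x xs)
  show ?case
  proof (cases "hd xs \<in> V")
    case True
    then show ?thesis using cons by (auto simp: successively_Cons)
  next
    case False
    then have "R x (hd xs)" "x \<in> V" "hd xs \<in> set xs"
      using cons by (auto simp: successively_Cons)
    with False show ?thesis by auto
  qed
qed simp

lemma spanning_grown_tree:
  assumes G: "finite_graph G" "connected_graph G" "verts G \<noteq> {}"
  obtains E where "E \<subseteq> edges G" "grown_tree (verts G) E"
proof -
  \<comment> \<open>A grown subtree with the largest number of vertices must be spanning.\<close>
  define P where "P V \<longleftrightarrow> V \<subseteq> verts G \<and> (\<exists>E\<subseteq>edges G. grown_tree V E)" for V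
  obtain r where "r \<in> verts G" using G by auto
  then have r: "P {r}" unfolding P_def using grown_tree.single[of r]
    by (intro conjI exI[of _ "{}"]) simp_all
  have fin: "finite (verts G)" using G by (simp add: finite_graph_def)
  then have "\<forall>V. P V \<longrightarrow> card V < Suc (card (verts G))"
    by (simp add: P_def card_mono less_Suc_eq_le)
  from ex_has_greatest_nat[of P, OF r this]
  obtain V where V: "P V" and max: "\<forall>V'. P V' \<longrightarrow> card V' \<le> card V" by (elim exE conjE)
  have sub: "V \<subseteq> verts G" using V by (simp add: P_def)
  obtain E where E: "E \<subseteq> edges G" "grown_tree V E" using V unfolding P_def by blast
  have "V = verts G"
  proof (rule ccontr)
    assume "V \<noteq> verts G"
    then obtain z where z: "z \<in> verts G" "z \<notin> V" using sub by blast
    have "V \<noteq> {}" using E(2) by cases auto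
    then obtain u where u: "u \<in> V" by blast
    then obtain xs where xs: "is_path G u xs z" using G(2) z(1) subsetD[OF sub u] unfolding connected_graph_def by blast
    then obtain x y where xy: "{y, x} \<in> edges G" "y \<in> V" "x \<notin> V" "x \<in> verts G"
      using crossing_edge[of "\<lambda>x y. {x, y} \<in> edges G" xs V] u z by (auto simp: is_path_def)
    have "grown_tree (insert x V) (insert {x, y} E)"
      using E(2) xy by (intro grown_tree.add_leaf)
    moreover have "insert {x, y} E \<subseteq> edges G" using xy(1) E(1) by (simp add: insert_commute)
    moreover have "insert x V \<subseteq> verts G" using xy(4) sub by simp
    ultimately have "P (insert x V)" unfolding P_def by blast
    then have "card (insert x V) \<le> card V" using max by simp
    moreover have "finite V" using sub fin by (rule finite_subset)
    ultimately show False using xy(3) by simp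
  qed
  then show ?thesis using that E by blast
qed

text \<open>A spanning tree misses no edge of an acyclic graph, since a missing edge would close a cycle
  with a path of the spanning tree.\<close>

lemma tree_is_grown:
  assumes T: "is_tree G" "verts G \<noteq> {}"
  shows "grown_tree (verts G) (edges G)"
proof -
  have G: "finite_graph G" "connected_graph G" using T by (auto simp: is_tree_def)
  obtain E where E: "E \<subseteq> edges G" "grown_tree (verts G) E"
    using spanning_grown_tree[OF G T(2)] .
  have "e \<in> E" if e: "e \<in> edges G" for e
  proof (rule ccontr)
    assume ne: "e \<notin> E"
    have "card e = 2" "e \<subseteq> verts G" using e G by (auto simp: finite_graph_def)
    then obtain u v where uv: "e = {u, v}" "u \<noteq> v" "u \<in> verts G" "v \<in> verts G"
      by (auto simp: card_2_iff)
    then obtain xs where xs: "is_path (verts G, E) u xs v"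
      using connected_grown_tree[OF E(2)] by (auto simp: connected_graph_def)
    have "length xs \<ge> 3"
    proof (rule ccontr)
      assume "\<not> length xs \<ge> 3"
      then have "length xs = 0 \<or> length xs = 1 \<or> length xs = 2" by linarith
      then show False using xs uv ne
        by (auto simp: is_path_def length_Suc_conv numeral_2_eq_2)
    qed
    moreover have "is_path G u xs v"
      using is_path_mono[OF xs, of "verts G" "edges G"] E(1) by simp
    ultimately have "is_cycle G xs"
      using e uv by (auto simp: is_path_def is_cycle_def insert_commute)
    then show False using T by (auto simp: is_tree_def)
  qed
  then have "E = edges G" using E(1) by blast
  then show ?thesis using E(2) by simp
qed

section \<open>The lower bound\<close>

text \<open>The sums of \<open>d\<close> over the three perfect matchings of four points, listed with the pairing
  \<open>ab|ce\<close> first.\<close>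

definition matching_sums :: "('a \<Rightarrow> 'a \<Rightarrow> real) \<Rightarrow> 'a \<Rightarrow> 'a \<Rightarrow> 'a \<Rightarrow> 'a \<Rightarrow> real set" where
  "matching_sums d a b c e = {d a b + d c e, d a c + d b e, d a e + d b c}"

abbreviation min_max_sum :: "('a \<Rightarrow> 'a \<Rightarrow> real) \<Rightarrow> 'a \<Rightarrow> 'a \<Rightarrow> 'a \<Rightarrow> 'a \<Rightarrow> real" where
  "min_max_sum d a b c e \<equiv> Min (matching_sums d a b c e) + Max (matching_sums d a b c e)"

lemma matching_sums_swap:
  assumes "pseudo_metric_on V d" "a \<in> V" "b \<in> V" "c \<in> V" "e \<in> V"
  shows "matching_sums d b a c e = matching_sums d a b c e"
    "matching_sums d a c b e = matching_sums d a b c e"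
    "matching_sums d a b e c = matching_sums d a b c e"
proof -
  have "d x y = d y x" if "x \<in> V" "y \<in> V" for x y
    using assms(1) that by (simp add: pseudo_metric_on_def)
  then have "d b a = d a b" "d c b = d b c" "d e c = d c e" using assms by simp_all
  then show "matching_sums d b a c e = matching_sums d a b c e"
    "matching_sums d a c b e = matching_sums d a b c e"
    "matching_sums d a b e c = matching_sums d a b c e"
    by (auto simp: matching_sums_def add.commute)
qed

text \<open>The slack \<open>t\<close> allows for moving one of the four points by a distance \<open>t\<close>, which changes each
  matching sum by at most \<open>t\<close>.\<close>

lemma Min_plus_Max_3_mono:
  fixes A B C t :: real
  assumes "A' \<le> A + t" "B' \<le> B + t" "C' \<le> C + t"
  shows "Min {A', B', C'} + Max {A', B', C'} \<le> 2 * t + (Min {A, B, C} + Max {A, B, C})"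
proof -
  have "Min {A', B', C'} \<le> Min {A, B, C} + t" "Max {A', B', C'} \<le> Max {A, B, C} + t"
    using assms by (simp_all add: min_def max_def)
  then show ?thesis by linarith
qed

text \<open>The points \<open>a\<close>, \<open>b\<close>, \<open>c\<close>, \<open>e\<close> need not be distinct: the induction replaces every occurrence of
  a new leaf by its neighbour, so that coincidences arise even from distinct points.\<close>

lemma four_point_bound:
  assumes "grown_tree V E" "pseudo_metric_on V d"
    "\<And>x y. {x, y} \<in> E \<Longrightarrow> d x y \<le> \<omega> {x, y}"
    "a \<in> V" "b \<in> V" "c \<in> V" "e \<in> V"
  shows "min_max_sum d a b c e \<le> 2 * sum \<omega> E"
  using assms
proof (induction arbitrary: a b c e rule: grown_tree.induct)
  case (single x)
  then show ?case by (simp add: pseudo_metric_on_def matching_sums_def)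
next
  case (add_leaf V E y x)
  define t where "t = \<omega> {x, y}"
  let ?Q = "\<lambda>a b c e. min_max_sum d a b c e \<le> 2 * t + 2 * sum \<omega> E"
  have fg: "finite_graph (V, E)" using finite_graph_grown_tree[OF add_leaf.hyps(1)] .
  then have "{x, y} \<notin> E" using add_leaf.hyps by (auto simp: finite_graph_def)
  then have W: "sum \<omega> (insert {x, y} E) = t + sum \<omega> E"
    using finite_edges[OF fg] by (simp add: t_def)
  have pm: "pseudo_metric_on V d" using add_leaf.prems(1) by (simp add: pseudo_metric_on_def)
  have IH: "min_max_sum d a b c e \<le> 2 * sum \<omega> E"
    if "a \<in> V" "b \<in> V" "c \<in> V" "e \<in> V" for a b c e
    using add_leaf.IH[OF pm _ that] add_leaf.prems(2) by blast
  have xy: "d x y \<le> t" using add_leaf.prems(2) by (auto simp: t_def)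
  have zero: "d u u = 0" if "u \<in> insert x V" for u
    using add_leaf.prems(1) that unfolding pseudo_metric_on_def by blast
  have sym: "d u v = d v u" and pos: "d u v \<ge> 0"
    if "u \<in> insert x V" "v \<in> insert x V" for u v
    using add_leaf.prems(1) that unfolding pseudo_metric_on_def by blast+
  have tri: "d u w \<le> d u v + d v w"
    if "u \<in> insert x V" "v \<in> insert x V" "w \<in> insert x V" for u v w
    using add_leaf.prems(1) that unfolding pseudo_metric_on_def by blast
  have le: "d x u \<le> t + d y u" if "u \<in> V" for u
    using tri[of x y u] xy that add_leaf.hyps by simp
  have yV: "y \<in> V" by fact
  have t: "t \<ge> 0" using pos[of x y] xy yV by simp
  \<comment> \<open>One case for each number of points that coincide with the new leaf \<open>x\<close>. A pair of them
    contributes nothing to the matching that joins it, and the other two matchings are then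
    equal, so the smallest sum does not use the new edge.\<close>
  have Q0: "?Q a b c e" if "a \<in> V" "b \<in> V" "c \<in> V" "e \<in> V" for a b c e
    using IH[OF that] t by simp
  have Q1: "?Q x b c e" if v: "b \<in> V" "c \<in> V" "e \<in> V" for b c e
  proof -
    have "min_max_sum d x b c e \<le> 2 * t + min_max_sum d y b c e"
      unfolding matching_sums_def using le[OF v(1)] le[OF v(2)] le[OF v(3)]
      by (intro Min_plus_Max_3_mono) simp_all
    with IH[OF yV v] show ?thesis by simp
  qed
  have Q2: "?Q x x c e" if v: "c \<in> V" "e \<in> V" for c e
    using IH[OF yV yV v] le[OF v(1)] le[OF v(2)] tri[of c y e] tri[of c x e] v yV
      zero[of x] zero[of y] sym[of c y] sym[of c x] t
    by (simp add: matching_sums_def min_def max_def split: if_splits)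
  have Q3: "?Q x x x e" if v: "e \<in> V" for e
    using IH[OF yV yV yV v] le[OF v] zero[of x] zero[of y] yV
    by (simp add: matching_sums_def min_def max_def split: if_splits)
  have Q4: "?Q x x x x"
    using IH[OF yV yV yV yV] zero[of x] zero[of y] yV t
    by (simp add: matching_sums_def min_def max_def split: if_splits)
  have swap: "matching_sums d u x c e = matching_sums d x u c e"
    "matching_sums d c u x e = matching_sums d c x u e"
    "matching_sums d c e u x = matching_sums d c e x u"
    if "u \<in> V" "c \<in> insert x V" "e \<in> insert x V" for u c e
    using matching_sums_swap[OF add_leaf.prems(1)] that by auto
  have "?Q a b c e"
    using add_leaf.prems(3-) by (auto simp: swap Q0 Q1 Q2 Q3 Q4)
  then show ?case using W by simp
qed

lemma filling_dist_pseudo_metric: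
  assumes "filling M \<rho> G \<omega>"
  shows "pseudo_metric_on (verts G) (graph_dist G \<omega>)"
  using assms by (intro pseudo_metric_graph_dist) (simp_all add: filling_def joins_def)

lemma min_max_sum_mono:
  assumes "\<And>x y. x \<in> {a, b, c, e} \<Longrightarrow> y \<in> {a, b, c, e} \<Longrightarrow> d x y \<le> d' x y"
  shows "min_max_sum d a b c e \<le> min_max_sum d' a b c e"
proof -
  have "d a b \<le> d' a b" "d c e \<le> d' c e" "d a c \<le> d' a c" "d b e \<le> d' b e"
    "d a e \<le> d' a e" "d b c \<le> d' b c" using assms by auto
  then have "min_max_sum d a b c e \<le> 2 * 0 + min_max_sum d' a b c e"
    unfolding matching_sums_def by (intro Min_plus_Max_3_mono) simp_all
  then show ?thesis by simp
qed

lemma filling_weight_ge: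
  assumes F: "filling {a, b, c, e} \<rho> G \<omega>"
  shows "min_max_sum \<rho> a b c e \<le> 2 * graph_weight G \<omega>"
proof -
  let ?d = "graph_dist G \<omega>"
  have G: "finite_graph G" "connected_graph G" and V: "{a, b, c, e} \<subseteq> verts G"
    and nn: "\<forall>e\<in>edges G. \<omega> e \<ge> 0"
    and le: "\<And>x y. x \<in> {a, b, c, e} \<Longrightarrow> y \<in> {a, b, c, e} \<Longrightarrow> \<rho> x y \<le> ?d x y"
    using F by (auto simp: filling_def joins_def)
  obtain E where E: "E \<subseteq> edges G" "grown_tree (verts G) E"
    using spanning_grown_tree[OF G] V by auto
  have "min_max_sum \<rho> a b c e \<le> min_max_sum ?d a b c e"
    using le by (rule min_max_sum_mono)
  also have "\<dots> \<le> 2 * sum \<omega> E"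
    using four_point_bound[OF E(2) pseudo_metric_graph_dist[OF G nn], of \<omega>]
      graph_dist_edge_le[OF G(1), of _ _ \<omega>] E(1) V by blast
  also have "sum \<omega> E \<le> sum \<omega> (edges G)"
    using nn E(1) finite_edges[OF G(1)] by (intro sum_mono2) auto
  finally show ?thesis by (simp add: graph_weight_def)
qed

section \<open>Mustache trees\<close>

text \<open>The edges of the binary tree with mustaches \<open>{a, b}\<close> at \<open>v\<close> and \<open>{c, e}\<close> at \<open>w\<close>.\<close>

definition mustache_edges :: "'a \<Rightarrow> 'a \<Rightarrow> 'a \<Rightarrow> 'a \<Rightarrow> 'a \<Rightarrow> 'a \<Rightarrow> 'a set set" where
  "mustache_edges a b c e v w = {{v, a}, {v, b}, {v, w}, {w, c}, {w, e}}"

lemma grown_mustache: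
  assumes "distinct [a, b, c, e, v, w]"
  shows "grown_tree {a, b, c, e, v, w} (mustache_edges a b c e v w)"
proof -
  have "grown_tree {a} {}" by (rule grown_tree.single)
  then have "grown_tree (insert v {a}) (insert {v, a} {})"
    by (rule grown_tree.add_leaf) (use assms in auto)
  then have "grown_tree (insert b (insert v {a})) (insert {b, v} (insert {v, a} {}))"
    by (rule grown_tree.add_leaf) (use assms in auto)
  then have "grown_tree (insert w (insert b (insert v {a})))
      (insert {w, v} (insert {b, v} (insert {v, a} {})))"
    by (rule grown_tree.add_leaf) (use assms in auto)
  then have "grown_tree (insert c (insert w (insert b (insert v {a}))))
      (insert {c, w} (insert {w, v} (insert {b, v} (insert {v, a} {}))))"
    by (rule grown_tree.add_leaf) (use assms in auto)
  then have "grown_tree (insert e (insert c (insert w (insert b (insert v {a})))))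
      (insert {e, w} (insert {c, w} (insert {w, v} (insert {b, v} (insert {v, a} {})))))"
    by (rule grown_tree.add_leaf) (use assms in auto)
  then show ?thesis by (simp add: mustache_edges_def insert_commute)
qed

lemma joins_mustache:
  assumes "distinct [a, b, c, e, v, w]"
  shows "joins ({a, b, c, e, v, w}, mustache_edges a b c e v w) {a, b, c, e}"
  using finite_graph_grown_tree[OF grown_mustache[OF assms]]
    connected_grown_tree[OF grown_mustache[OF assms]] by (auto simp: joins_def)

lemma mustache_tree_eq:
  "mustache_tree M a b c e G \<longleftrightarrow>
    (\<exists>v w. v \<noteq> w \<and> v \<notin> M \<and> w \<notin> M \<and> G = (M \<union> {v, w}, mustache_edges a b c e v w))"
  by (simp add: mustache_tree_def mustache_edges_def)

lemma graph_weight_mustache: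
  assumes "distinct [a, b, c, e, v, w]"
  shows "graph_weight (V, mustache_edges a b c e v w) \<omega> =
    \<omega> {v, a} + \<omega> {v, b} + \<omega> {v, w} + \<omega> {w, c} + \<omega> {w, e}"
  using assms by (auto simp: graph_weight_def mustache_edges_def doubleton_eq_iff)

text \<open>In a mustache filling of optimal weight the pairing of the mustaches attains the minimum.\<close>

lemma mustache_filling_min:
  assumes F: "filling {a, b, c, e} \<rho> (V, mustache_edges a b c e v w) \<omega>"
    and dist: "distinct [a, b, c, e, v, w]"
    and W: "2 * graph_weight (V, mustache_edges a b c e v w) \<omega> = min_max_sum \<rho> a b c e"
  shows "Min (matching_sums \<rho> a b c e) = \<rho> a b + \<rho> c e"
proof -
  let ?G = "(V, mustache_edges a b c e v w)"
  let ?d = "graph_dist ?G \<omega>"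
  have G: "finite_graph ?G" "connected_graph ?G" and nn: "\<forall>e\<in>edges ?G. \<omega> e \<ge> 0"
    and le: "\<And>x y. x \<in> {a, b, c, e} \<Longrightarrow> y \<in> {a, b, c, e} \<Longrightarrow> \<rho> x y \<le> ?d x y"
    using F by (auto simp: filling_def joins_def)
  have E: "{v, a} \<in> edges ?G" "{v, b} \<in> edges ?G" "{v, w} \<in> edges ?G"
      "{w, c} \<in> edges ?G" "{w, e} \<in> edges ?G"
    by (simp_all add: mustache_edges_def)
  then have V: "a \<in> V" "b \<in> V" "c \<in> V" "e \<in> V" "v \<in> V" "w \<in> V"
    using G(1) by (auto simp: finite_graph_def)
  have dE: "?d v a \<le> \<omega> {v, a}" "?d v b \<le> \<omega> {v, b}" "?d v w \<le> \<omega> {v, w}"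
      "?d w c \<le> \<omega> {w, c}" "?d w e \<le> \<omega> {w, e}"
    using E graph_dist_edge_le[OF G(1)] by auto
  have pm: "pseudo_metric_on V ?d" using pseudo_metric_graph_dist[OF G nn] by simp
  have tri: "?d x z \<le> ?d y x + ?d y z" "?d x z \<le> ?d x y + ?d y z"
      if "x \<in> V" "y \<in> V" "z \<in> V" for x y z
    using pm that unfolding pseudo_metric_on_def by metis+
  have "\<rho> a b \<le> ?d a b" "\<rho> c e \<le> ?d c e" "\<rho> a c \<le> ?d a c" "\<rho> b e \<le> ?d b e"
    "\<rho> a e \<le> ?d a e" "\<rho> b c \<le> ?d b c" using le by auto
  moreover have "?d a b \<le> ?d v a + ?d v b" "?d c e \<le> ?d w c + ?d w e"
    "?d a c \<le> ?d v a + ?d v c" "?d b e \<le> ?d v b + ?d v e"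
    "?d a e \<le> ?d v a + ?d v e" "?d b c \<le> ?d v b + ?d v c"
    "?d v c \<le> ?d v w + ?d w c" "?d v e \<le> ?d v w + ?d w e"
    using tri V by auto
  moreover have "\<omega> {v, w} \<ge> 0" using E(3) nn by blast
  ultimately have "\<rho> a b + \<rho> c e \<le> graph_weight ?G \<omega> - \<omega> {v, w}"
     "\<rho> a c + \<rho> b e \<le> graph_weight ?G \<omega> + \<omega> {v, w}"
     "\<rho> a e + \<rho> b c \<le> graph_weight ?G \<omega> + \<omega> {v, w}" "\<omega> {v, w} \<ge> 0"
    unfolding graph_weight_mustache[OF dist] using dE by linarith+
  then show ?thesis using W
    by (auto simp: matching_sums_def min_def max_def split: if_splits)
qed

lemma mustache_edges_swap:
  "mustache_edges b a c e v w = mustache_edges a b c e v w"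
  "mustache_edges a b e c v w = mustache_edges a b c e v w"
  "mustache_edges c e a b w v = mustache_edges a b c e v w"
  by (auto simp: mustache_edges_def insert_commute)

text \<open>The potential is the distance from \<open>a\<close> in the weighted tree.\<close>

lemma mustache_potential:
  assumes dist: "distinct [a, b, c, e, v, w]"
    and nn: "\<forall>z\<in>mustache_edges a b c e v w. \<omega> z \<ge> (0::real)"
  obtains h where "h a = 0" "h b = \<omega> {v, a} + \<omega> {v, b}"
    "h c = \<omega> {v, a} + \<omega> {v, w} + \<omega> {w, c}" "h e = \<omega> {v, a} + \<omega> {v, w} + \<omega> {w, e}"
    "\<forall>x y. {x, y} \<in> mustache_edges a b c e v w \<longrightarrow> h y - h x \<le> \<omega> {x, y}"
proof -
  define h where "h = (\<lambda>_. 0)(v := \<omega> {v, a}, b := \<omega> {v, a} + \<omega> {v, b}, w := \<omega> {v, a} + \<omega> {v, w},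
    c := \<omega> {v, a} + \<omega> {v, w} + \<omega> {w, c}, e := \<omega> {v, a} + \<omega> {v, w} + \<omega> {w, e})"
  have h: "h a = 0" "h v = \<omega> {v, a}" "h b = \<omega> {v, a} + \<omega> {v, b}" "h w = \<omega> {v, a} + \<omega> {v, w}"
    "h c = \<omega> {v, a} + \<omega> {v, w} + \<omega> {w, c}" "h e = \<omega> {v, a} + \<omega> {v, w} + \<omega> {w, e}"
    using dist by (auto simp: h_def)
  have "\<omega> {v, a} \<ge> 0" "\<omega> {v, b} \<ge> 0" "\<omega> {v, w} \<ge> 0" "\<omega> {w, c} \<ge> 0" "\<omega> {w, e} \<ge> 0"
    using nn by (simp_all add: mustache_edges_def)
  then have "\<forall>x y. {x, y} \<in> mustache_edges a b c e v w \<longrightarrow> h y - h x \<le> \<omega> {x, y}"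
    using dist by (auto simp: mustache_edges_def doubleton_eq_iff h insert_commute)
  with h that show ?thesis by blast
qed

lemma mustache_fillingI:
  assumes dist: "distinct [a, b, c, e, v, w]" and pm: "pseudo_metric_on {a, b, c, e} \<rho>"
    and nn: "\<forall>z\<in>mustache_edges a b c e v w. \<omega> z \<ge> 0"
    and le: "\<rho> a b \<le> \<omega> {v, a} + \<omega> {v, b}" "\<rho> c e \<le> \<omega> {w, c} + \<omega> {w, e}"
      "\<rho> a c \<le> \<omega> {v, a} + \<omega> {v, w} + \<omega> {w, c}" "\<rho> b e \<le> \<omega> {v, b} + \<omega> {v, w} + \<omega> {w, e}"
      "\<rho> a e \<le> \<omega> {v, a} + \<omega> {v, w} + \<omega> {w, e}" "\<rho> b c \<le> \<omega> {v, b} + \<omega> {v, w} + \<omega> {w, c}"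
  shows "filling {a, b, c, e} \<rho> ({a, b, c, e, v, w}, mustache_edges a b c e v w) \<omega>"
proof (rule filling_by_potentials[OF joins_mustache[OF dist]])
  let ?E = "mustache_edges a b c e v w"
  let ?ok = "\<lambda>h. \<forall>x y. {x, y} \<in> ?E \<longrightarrow> h y - h x \<le> \<omega> {x, y}"
  have zero: "\<rho> a a = 0" "\<rho> b b = 0" "\<rho> c c = 0" "\<rho> e e = 0"
    and sym: "\<rho> b a = \<rho> a b" "\<rho> c a = \<rho> a c" "\<rho> e a = \<rho> a e" "\<rho> c b = \<rho> b c" "\<rho> e b = \<rho> b e"
      "\<rho> e c = \<rho> c e"
    using pm unfolding pseudo_metric_on_def by blast+
  have wv: "{w, v} = {v, w}" by (rule insert_commute)
  note sw = mustache_edges_swap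
  obtain ha where ha: "ha a = 0" "ha b = \<omega> {v, a} + \<omega> {v, b}"
    "ha c = \<omega> {v, a} + \<omega> {v, w} + \<omega> {w, c}" "ha e = \<omega> {v, a} + \<omega> {v, w} + \<omega> {w, e}" "?ok ha"
    using mustache_potential[OF dist nn] .
  obtain hb where hb: "hb b = 0" "hb a = \<omega> {v, b} + \<omega> {v, a}"
    "hb c = \<omega> {v, b} + \<omega> {v, w} + \<omega> {w, c}" "hb e = \<omega> {v, b} + \<omega> {v, w} + \<omega> {w, e}" "?ok hb"
    using mustache_potential[of b a c e v w \<omega>] dist nn unfolding sw(1)[of b a] by auto
  obtain hc where hc: "hc c = 0" "hc e = \<omega> {w, c} + \<omega> {w, e}"
    "hc a = \<omega> {w, c} + \<omega> {v, w} + \<omega> {v, a}" "hc b = \<omega> {w, c} + \<omega> {v, w} + \<omega> {v, b}" "?ok hc"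
    using mustache_potential[of c e a b w v \<omega>] dist nn unfolding sw(3)[of c e a b] wv by auto
  obtain he where he: "he e = 0" "he c = \<omega> {w, e} + \<omega> {w, c}"
    "he a = \<omega> {w, e} + \<omega> {v, w} + \<omega> {v, a}" "he b = \<omega> {w, e} + \<omega> {v, w} + \<omega> {v, b}" "?ok he"
    using mustache_potential[of e c a b w v \<omega>] dist nn unfolding sw(3)[of e c a b] sw(2)[of a b e c] wv
    by auto
  fix x y assume x: "x \<in> {a, b, c, e}" and y: "y \<in> {a, b, c, e}"
  consider "x = a" | "x = b" | "x = c" | "x = e" using x by blast
  then have "\<exists>h. \<rho> x y \<le> h y - h x \<and> ?ok h"
  proof cases
    case 1
    then show ?thesis using y ha le zero sym by (intro exI[of _ ha] conjI) auto
  next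
    case 2
    then show ?thesis using y hb le zero sym by (intro exI[of _ hb] conjI) auto
  next
    case 3
    then show ?thesis using y hc le zero sym by (intro exI[of _ hc] conjI) auto
  next
    case 4
    then show ?thesis using y he le zero sym by (intro exI[of _ he] conjI) auto
  qed
  then show "\<exists>h. \<rho> x y \<le> h y - h x \<and>
      (\<forall>u z. {u, z} \<in> edges ({a, b, c, e, v, w}, ?E) \<longrightarrow> h z - h u \<le> \<omega> {u, z})" by simp
qed (use nn in simp)

text \<open>Weights for the mustache tree \<open>ab|ce\<close> when \<open>ac + be\<close> is the largest matching sum. Optimality
  forces equality in the conditions on \<open>ab\<close>, \<open>ce\<close>, \<open>ac\<close> and \<open>be\<close>, which leaves \<open>\<alpha>\<close> as the
  only free parameter.\<close>

lemma optimal_mustache_weights: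
  fixes ab ac ae bc be ce :: real
  assumes nn: "ab \<ge> 0" "ac \<ge> 0" "ae \<ge> 0" "bc \<ge> 0" "be \<ge> 0" "ce \<ge> 0"
    and tri: "ac \<le> ab + bc" "ac \<le> ae + ce" "ae \<le> ac + ce" "be \<le> ab + ae" "be \<le> bc + ce"
      "bc \<le> ab + ac" "bc \<le> be + ce" "ae \<le> ab + be"
    and min: "ab + ce \<le> ac + be" and max: "ae + bc \<le> ac + be"
  obtains \<alpha> \<beta> \<mu> \<gamma> \<delta> where "\<alpha> \<ge> 0" "\<beta> \<ge> 0" "\<mu> \<ge> 0" "\<gamma> \<ge> 0" "\<delta> \<ge> 0"
    "ab \<le> \<alpha> + \<beta>" "ce \<le> \<gamma> + \<delta>" "ac \<le> \<alpha> + \<mu> + \<gamma>" "be \<le> \<beta> + \<mu> + \<delta>"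
    "ae \<le> \<alpha> + \<mu> + \<delta>" "bc \<le> \<beta> + \<mu> + \<gamma>"
    "2 * (\<alpha> + \<beta> + \<mu> + \<gamma> + \<delta>) = (ab + ce) + (ac + be)"
proof -
  \<comment> \<open>The conditions \<open>\<alpha> \<ge> 0\<close> and \<open>ae \<le> \<alpha> + \<mu> + \<delta>\<close> bound \<open>\<alpha>\<close> from below, and imply
    \<open>\<delta> \<ge> 0\<close>. The least value that they allow is compatible with all the upper bounds.\<close>
  define \<mu> where "\<mu> = (ac + be - ab - ce) / 2"
  define \<alpha> where "\<alpha> = max 0 ((ae + ac - ce) / 2 - \<mu>)"
  define \<beta> where "\<beta> = ab - \<alpha>"
  define \<gamma> where "\<gamma> = ac - \<mu> - \<alpha>"
  define \<delta> where "\<delta> = ce - \<gamma>"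
  have "\<mu> \<ge> 0" using min by (simp add: \<mu>_def)
  have a: "\<alpha> \<ge> 0" "\<alpha> \<ge> (ae + ac - ce) / 2 - \<mu>" by (simp_all add: \<alpha>_def)
  have up: "\<alpha> \<le> ac - \<mu>" "\<alpha> \<le> (ab + ac - bc) / 2"
    using assms by (simp_all add: \<alpha>_def \<mu>_def field_simps)
  show ?thesis
  proof (rule that[of \<alpha> \<beta> \<mu> \<gamma> \<delta>])
  qed (use a up \<open>\<mu> \<ge> 0\<close> assms in \<open>simp_all add: \<beta>_def \<gamma>_def \<delta>_def, (simp_all add: \<mu>_def field_simps)?\<close>)
qed


lemma optimal_mustache_filling_aux:
  assumes dist: "distinct [a, b, c, e, v, w]" and pm: "pseudo_metric_on {a, b, c, e} \<rho>"
    and min: "\<rho> a b + \<rho> c e \<le> \<rho> a c + \<rho> b e" and max: "\<rho> a e + \<rho> b c \<le> \<rho> a c + \<rho> b e"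
  shows "\<exists>\<omega>. filling {a, b, c, e} \<rho> ({a, b, c, e, v, w}, mustache_edges a b c e v w) \<omega> \<and>
    2 * graph_weight ({a, b, c, e, v, w}, mustache_edges a b c e v w) \<omega> =
      (\<rho> a b + \<rho> c e) + (\<rho> a c + \<rho> b e)"
proof -
  have nonneg: "\<rho> x y \<ge> 0" and sym: "\<rho> x y = \<rho> y x"
    if "x \<in> {a, b, c, e}" "y \<in> {a, b, c, e}" for x y
    using pm that unfolding pseudo_metric_on_def by blast+
  have tri: "\<rho> x z \<le> \<rho> x y + \<rho> y z"
    if "x \<in> {a, b, c, e}" "y \<in> {a, b, c, e}" "z \<in> {a, b, c, e}" for x y z
    using pm that unfolding pseudo_metric_on_def by blast
  have nn: "\<rho> a b \<ge> 0" "\<rho> a c \<ge> 0" "\<rho> a e \<ge> 0" "\<rho> b c \<ge> 0" "\<rho> b e \<ge> 0" "\<rho> c e \<ge> 0"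
    by (rule nonneg; simp)+
  have "\<rho> e c = \<rho> c e" "\<rho> b a = \<rho> a b" by (rule sym; simp)+
  then have tris: "\<rho> a c \<le> \<rho> a b + \<rho> b c" "\<rho> a c \<le> \<rho> a e + \<rho> c e" "\<rho> a e \<le> \<rho> a c + \<rho> c e"
      "\<rho> b e \<le> \<rho> a b + \<rho> a e" "\<rho> b e \<le> \<rho> b c + \<rho> c e" "\<rho> b c \<le> \<rho> a b + \<rho> a c"
      "\<rho> b c \<le> \<rho> b e + \<rho> c e" "\<rho> a e \<le> \<rho> a b + \<rho> b e"
    using tri[of a b c] tri[of a e c] tri[of a c e] tri[of b a e] tri[of b c e] tri[of b a c]
      tri[of b e c] tri[of a b e] by simp_all
  obtain \<alpha> \<beta> \<mu> \<gamma> \<delta> where nn: "\<alpha> \<ge> 0" "\<beta> \<ge> 0" "\<mu> \<ge> 0" "\<gamma> \<ge> 0" "\<delta> \<ge> 0"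
    and le: "\<rho> a b \<le> \<alpha> + \<beta>" "\<rho> c e \<le> \<gamma> + \<delta>" "\<rho> a c \<le> \<alpha> + \<mu> + \<gamma>" "\<rho> b e \<le> \<beta> + \<mu> + \<delta>"
    "\<rho> a e \<le> \<alpha> + \<mu> + \<delta>" "\<rho> b c \<le> \<beta> + \<mu> + \<gamma>"
    and W: "2 * (\<alpha> + \<beta> + \<mu> + \<gamma> + \<delta>) = (\<rho> a b + \<rho> c e) + (\<rho> a c + \<rho> b e)"
    using optimal_mustache_weights[OF nn tris min max] .
  define \<omega> where "\<omega> = (\<lambda>_. 0)({v, a} := \<alpha>, {v, b} := \<beta>, {v, w} := \<mu>, {w, c} := \<gamma>, {w, e} := \<delta>)"
  have \<omega>: "\<omega> {v, a} = \<alpha>" "\<omega> {v, b} = \<beta>" "\<omega> {v, w} = \<mu>" "\<omega> {w, c} = \<gamma>" "\<omega> {w, e} = \<delta>"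
    using dist by (auto simp: \<omega>_def doubleton_eq_iff)
  have "\<forall>z\<in>mustache_edges a b c e v w. \<omega> z \<ge> 0" using nn \<omega> by (simp add: mustache_edges_def)
  then have "filling {a, b, c, e} \<rho> ({a, b, c, e, v, w}, mustache_edges a b c e v w) \<omega>"
    using le by (intro mustache_fillingI[OF dist pm]) (simp_all add: \<omega>)
  moreover have "2 * graph_weight ({a, b, c, e, v, w}, mustache_edges a b c e v w) \<omega> =
      (\<rho> a b + \<rho> c e) + (\<rho> a c + \<rho> b e)"
    unfolding graph_weight_mustache[OF dist] \<omega> using W by simp
  ultimately show ?thesis by blast
qed

lemma optimal_mustache_filling:
  assumes dist: "distinct [a, b, c, e, v, w]" and pm: "pseudo_metric_on {a, b, c, e} \<rho>"
    and min: "Min (matching_sums \<rho> a b c e) = \<rho> a b + \<rho> c e"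
  shows "\<exists>\<omega>. filling {a, b, c, e} \<rho> ({a, b, c, e, v, w}, mustache_edges a b c e v w) \<omega> \<and>
    2 * graph_weight ({a, b, c, e, v, w}, mustache_edges a b c e v w) \<omega> = min_max_sum \<rho> a b c e"
proof -
  have le: "\<rho> a b + \<rho> c e \<le> \<rho> a c + \<rho> b e" "\<rho> a b + \<rho> c e \<le> \<rho> a e + \<rho> b c"
    using min by (auto simp: matching_sums_def min_def split: if_splits)
  have sym: "\<rho> e c = \<rho> c e" using pm unfolding pseudo_metric_on_def by blast
  show ?thesis
  proof (cases "\<rho> a e + \<rho> b c \<le> \<rho> a c + \<rho> b e")
    case True
    then have "Max (matching_sums \<rho> a b c e) = \<rho> a c + \<rho> b e"
      using le by (simp add: matching_sums_def max_def)
    then show ?thesis using optimal_mustache_filling_aux[OF dist pm le(1) True] min by simp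
  next
    case False
    then have "Max (matching_sums \<rho> a b c e) = \<rho> a e + \<rho> b c"
      using le by (simp add: matching_sums_def max_def)
    moreover have "{a, b, e, c} = {a, b, c, e}" "{a, b, e, c, v, w} = {a, b, c, e, v, w}" by auto
    moreover have "distinct [a, b, e, c, v, w]" using dist by auto
    ultimately show ?thesis using optimal_mustache_filling_aux[of a b e c v w \<rho>] pm le(2) False min sym
      by (simp add: mustache_edges_swap(2)[of a b e c])
  qed
qed

section \<open>Contracted edges\<close>

text \<open>The map \<open>f\<close> contracts the edge set \<open>C\<close> of \<open>T\<close>, fixes \<open>M\<close>, and maps the other edges
  bijectively onto those of \<open>G\<close>. The last clause asks that two distinct vertices with the same
  image be joined by at most two edges of \<open>C\<close>; this covers every contraction of a mustache tree
  used here and avoids transitive closures.\<close>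

definition edge_contraction :: "'a set \<Rightarrow> 'a graph \<Rightarrow> 'a set set \<Rightarrow> ('a \<Rightarrow> 'a) \<Rightarrow> 'a graph \<Rightarrow> bool" where
  "edge_contraction M T C f G \<longleftrightarrow> C \<subseteq> edges T \<and> f ` verts T = verts G \<and> (\<forall>x\<in>M. f x = x) \<and>
     bij_betw ((`) f) (edges T - C) (edges G) \<and>
     (\<forall>x y. {x, y} \<in> C \<longrightarrow> f x = f y) \<and>
     (\<forall>x\<in>verts T. \<forall>y\<in>verts T. f x = f y \<longrightarrow>
        x = y \<or> {x, y} \<in> C \<or> (\<exists>z. {x, z} \<in> C \<and> {z, y} \<in> C))"

text \<open>Edges of weight zero may be inserted into a filling: the distance from \<open>x\<close> in \<open>G\<close>, composed
  with the contraction, is a potential on \<open>T\<close>.\<close>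

lemma filling_edge_expansion:
  assumes F: "filling M \<rho> G \<omega>" and J: "joins T M" and con: "edge_contraction M T C f G"
  shows "\<exists>\<eta>. filling M \<rho> T \<eta> \<and> zero_contraction M T \<eta> G \<omega> \<and> graph_weight T \<eta> = graph_weight G \<omega>"
proof -
  let ?d = "graph_dist G \<omega>"
  define \<eta> where "\<eta> z = (if z \<in> C then 0 else \<omega> (f ` z))" for z
  have C: "C \<subseteq> edges T" and V: "f ` verts T = verts G" and fixM: "\<forall>x\<in>M. f x = x"
    and bij: "bij_betw ((`) f) (edges T - C) (edges G)"
    and const: "\<And>x y. {x, y} \<in> C \<Longrightarrow> f x = f y"
    and classes: "\<And>x y. x \<in> verts T \<Longrightarrow> y \<in> verts T \<Longrightarrow> f x = f y \<Longrightarrow>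
        x = y \<or> {x, y} \<in> C \<or> (\<exists>z. {x, z} \<in> C \<and> {z, y} \<in> C)"
    using con unfolding edge_contraction_def by blast+
  have G: "finite_graph G" and nn: "\<forall>z\<in>edges G. \<omega> z \<ge> 0"
    and le: "\<And>x y. x \<in> M \<Longrightarrow> y \<in> M \<Longrightarrow> \<rho> x y \<le> ?d x y"
    and pm: "pseudo_metric_on (verts G) ?d"
    using F filling_dist_pseudo_metric[OF F] by (auto simp: filling_def joins_def)
  have T: "finite_graph T" "M \<subseteq> verts T" using J by (auto simp: joins_def)
  have img: "f ` z \<in> edges G" if "z \<in> edges T" "z \<notin> C" for z
    using bij that by (auto simp: bij_betw_def)
  have "filling M \<rho> T \<eta>"
  proof (rule filling_by_potentials[OF J])
    show "\<forall>z\<in>edges T. \<eta> z \<ge> 0" using img nn by (auto simp: \<eta>_def)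
  next
    fix x y assume xy: "x \<in> M" "y \<in> M"
    have "?d x (f v) - ?d x (f u) \<le> \<eta> {u, v}" if uv: "{u, v} \<in> edges T" for u v
    proof -
      have "u \<in> verts T" "v \<in> verts T" using uv T by (auto simp: finite_graph_def)
      then have "f u \<in> verts G" "f v \<in> verts G" "x \<in> verts G" using V fixM xy T(2) by force+
      then have tri: "?d x (f v) \<le> ?d x (f u) + ?d (f u) (f v)"
        using pm unfolding pseudo_metric_on_def by blast
      have "?d (f u) (f v) \<le> \<omega> {f u, f v}" if "{u, v} \<notin> C"
        using img[OF uv that] graph_dist_edge_le[OF G] by simp
      then show ?thesis using tri const[of u v] by (auto simp: \<eta>_def)
    qed
    moreover have "?d x x = 0" using pm xy T(2) V fixM unfolding pseudo_metric_on_def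
      by (metis imageI subsetD)
    ultimately show "\<exists>h. \<rho> x y \<le> h y - h x \<and> (\<forall>u v. {u, v} \<in> edges T \<longrightarrow> h v - h u \<le> \<eta> {u, v})"
      using le[OF xy] fixM xy by (intro exI[of _ "\<lambda>z. ?d x (f z)"]) simp
  qed
  moreover have "zero_contraction M T \<eta> G \<omega>"
  proof -
    let ?R = "{(a, b). {a, b} \<in> C}\<^sup>*"
    have "f x = f y" if "(x, y) \<in> ?R" for x y
      using that by (induction rule: rtrancl_induct) (use const in auto)
    moreover have "(x, y) \<in> ?R" if xy: "x \<in> verts T" "y \<in> verts T" "f x = f y" for x y
    proof -
      have step: "(u, v) \<in> ?R" if "{u, v} \<in> C" for u v using that by blast
      from classes[OF xy] show ?thesis
        using step step[THEN rtrancl_trans, OF _ step] by blast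
    qed
    ultimately have "\<forall>x\<in>verts T. \<forall>y\<in>verts T. f x = f y \<longleftrightarrow> (x, y) \<in> ?R" by blast
    moreover have "C \<subseteq> {z \<in> edges T. \<eta> z = 0}" using C by (auto simp: \<eta>_def)
    moreover have "\<forall>z\<in>edges T - C. \<omega> (f ` z) = \<eta> z" by (simp add: \<eta>_def)
    ultimately show ?thesis unfolding zero_contraction_def using V fixM bij by blast
  qed
  moreover have "graph_weight T \<eta> = graph_weight G \<omega>"
  proof -
    have "sum \<eta> (edges T) = sum \<eta> (edges T - C)"
      using C finite_edges[OF T(1)] by (intro sum.mono_neutral_right) (auto simp: \<eta>_def)
    also have "\<dots> = sum (\<lambda>z. \<omega> (f ` z)) (edges T - C)" by (rule sum.cong) (auto simp: \<eta>_def)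
    also have "\<dots> = sum \<omega> (edges G)" by (rule sum.reindex_bij_betw[OF bij])
    finally show ?thesis by (simp add: graph_weight_def)
  qed
  ultimately show ?thesis by blast
qed

section \<open>Trees with at most four vertices of degree 1 or 2\<close>

text \<open>The vertices of degree 1 or 2; those of a reduced tree belong to \<open>M\<close>.\<close>

definition low_vertices :: "'a graph \<Rightarrow> 'a set" where
  "low_vertices G = {z \<in> verts G. degree G z \<in> {1, 2}}"

lemma degree_no_edges [simp]: "degree (V, {}) z = 0"
  by (simp add: degree_def)

lemma degree_insert_edge:
  assumes "finite E"
  shows "degree (V, insert e E) z = degree (V, E) z + of_bool (z \<in> e \<and> e \<notin> E)"
proof (cases "z \<in> e \<and> e \<notin> E")
  case True
  then have "{e' \<in> insert e E. z \<in> e'} = insert e {e' \<in> E. z \<in> e'}" by auto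
  then show ?thesis using True assms by (simp add: degree_def)
next
  case False
  then have "{e' \<in> insert e E. z \<in> e'} = {e' \<in> E. z \<in> e'}" by auto
  then show ?thesis using False by (simp add: degree_def)
qed

text \<open>A new leaf is itself of degree 1, and it removes a vertex from the set only if its neighbour
  had degree 2.\<close>

lemma card_low_vertices_add_leaf:
  assumes "grown_tree V E" "y \<in> V" "x \<notin> V"
  shows "card (low_vertices (V, E)) + of_bool (degree (V, E) y \<noteq> 2) \<le>
    card (low_vertices (insert x V, insert {x, y} E))"
proof -
  let ?L = "low_vertices (V, E)" and ?L' = "low_vertices (insert x V, insert {x, y} E)"
  have fg: "finite_graph (V, E)" using finite_graph_grown_tree[OF assms(1)] .
  then have fin: "finite E" "finite V" using finite_edges[OF fg] by (auto simp: finite_graph_def)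
  have new: "\<forall>e\<in>E. x \<notin> e" using fg assms(3) by (auto simp: finite_graph_def)
  then have deg: "degree (insert x V, insert {x, y} E) z = degree (V, E) z + of_bool (z \<in> {x, y})" for z
    by (subst degree_insert_edge[OF fin(1)]) (auto simp: degree_def)
  have "{e \<in> E. x \<in> e} = {}" using new by blast
  then have "degree (V, E) x = 0" by (simp only: degree_def snd_conv card.empty)
  then have x: "x \<in> ?L'" by (simp add: low_vertices_def deg)
  have finL: "finite ?L" "finite ?L'" using fin(2) by (simp_all add: low_vertices_def)
  have xL: "x \<notin> ?L" using assms(3) by (simp add: low_vertices_def)
  show ?thesis
  proof (cases "degree (V, E) y = 2")
    case True
    have "insert x (?L - {y}) \<subseteq> ?L'" using x by (auto simp: low_vertices_def deg)
    then have "card (insert x (?L - {y})) \<le> card ?L'" using finL by (intro card_mono)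
    moreover have "y \<in> ?L" using True assms(2) by (simp add: low_vertices_def)
    ultimately show ?thesis using True xL finL by (simp add: card.insert_remove card_Suc_Diff1)
  next
    case False
    have "insert x ?L \<subseteq> ?L'" using x False by (auto simp: low_vertices_def deg)
    then have "card (insert x ?L) \<le> card ?L'" using finL by (intro card_mono)
    then show ?thesis using False xL finL by simp
  qed
qed

text \<open>The star with centre \<open>s\<close> and three leaves.\<close>

definition star3 :: "'a graph \<Rightarrow> 'a \<Rightarrow> 'a \<Rightarrow> 'a \<Rightarrow> 'a \<Rightarrow> bool" where
  "star3 G s a b c \<longleftrightarrow> distinct [s, a, b, c] \<and> G = ({s, a, b, c}, {{s, a}, {s, b}, {s, c}})"

text \<open>The path with consecutive vertices \<open>a\<close>, \<open>b\<close>, \<open>c\<close>, \<open>e\<close>.\<close>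

definition path4 :: "'a graph \<Rightarrow> 'a \<Rightarrow> 'a \<Rightarrow> 'a \<Rightarrow> 'a \<Rightarrow> bool" where
  "path4 G a b c e \<longleftrightarrow> distinct [a, b, c, e] \<and> G = ({a, b, c, e}, {{a, b}, {b, c}, {c, e}})"

text \<open>The star with centre \<open>s\<close> and four leaves.\<close>

definition star4 :: "'a graph \<Rightarrow> 'a \<Rightarrow> 'a \<Rightarrow> 'a \<Rightarrow> 'a \<Rightarrow> 'a \<Rightarrow> bool" where
  "star4 G s a b c e \<longleftrightarrow> distinct [s, a, b, c, e] \<and>
     G = ({s, a, b, c, e}, {{s, a}, {s, b}, {s, c}, {s, e}})"

text \<open>The star with centre \<open>s\<close> and three leaves, one of whose edges is prolonged from \<open>c\<close> to \<open>e\<close>.\<close>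

definition spider :: "'a graph \<Rightarrow> 'a \<Rightarrow> 'a \<Rightarrow> 'a \<Rightarrow> 'a \<Rightarrow> 'a \<Rightarrow> bool" where
  "spider G s a b c e \<longleftrightarrow> distinct [s, a, b, c, e] \<and>
     G = ({s, a, b, c, e}, {{s, a}, {s, b}, {s, c}, {c, e}})"

text \<open>The binary tree with mustaches \<open>{a, b}\<close> at \<open>v\<close> and \<open>{c, e}\<close> at \<open>w\<close>, all vertices distinct.\<close>

definition mustache :: "'a graph \<Rightarrow> 'a \<Rightarrow> 'a \<Rightarrow> 'a \<Rightarrow> 'a \<Rightarrow> 'a \<Rightarrow> 'a \<Rightarrow> bool" where
  "mustache G a b c e v w \<longleftrightarrow> distinct [a, b, c, e, v, w] \<and>
     G = ({a, b, c, e, v, w}, mustache_edges a b c e v w)"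

lemma low_vertices_shapes:
  "star3 G s a b c \<Longrightarrow> low_vertices G = {a, b, c}"
  "path4 G a b c e \<Longrightarrow> low_vertices G = {a, b, c, e}"
  "star4 G s a b c e \<Longrightarrow> low_vertices G = {a, b, c, e}"
  "spider G s a b c e \<Longrightarrow> low_vertices G = {a, b, c, e}"
  "mustache G a b c e v w \<Longrightarrow> low_vertices G = {a, b, c, e}"
  by (auto simp: low_vertices_def star3_def path4_def star4_def spider_def mustache_def
      mustache_edges_def degree_insert_edge doubleton_eq_iff)

lemma degree_eq_2_shapes:
  "path4 G a b c e \<Longrightarrow> z \<in> verts G \<Longrightarrow> degree G z = 2 \<Longrightarrow> z = b \<or> z = c"
  "star4 G s a b c e \<Longrightarrow> z \<in> verts G \<Longrightarrow> degree G z \<noteq> 2"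
  "spider G s a b c e \<Longrightarrow> z \<in> verts G \<Longrightarrow> degree G z = 2 \<Longrightarrow> z = c"
  "mustache G a b c e v w \<Longrightarrow> z \<in> verts G \<Longrightarrow> degree G z \<noteq> 2"
  by (auto simp: path4_def star4_def spider_def mustache_def
      mustache_edges_def degree_insert_edge doubleton_eq_iff)

text \<open>The trees with exactly four vertices of degree 1 or 2.\<close>

inductive four_low_shape :: "'a graph \<Rightarrow> bool" where
  "path4 G a b c e \<Longrightarrow> four_low_shape G"
| "star4 G s a b c e \<Longrightarrow> four_low_shape G"
| "spider G s a b c e \<Longrightarrow> four_low_shape G"
| "mustache G a b c e v w \<Longrightarrow> four_low_shape G"

lemma card_low_vertices_four:
  "four_low_shape G \<Longrightarrow> card (low_vertices G) = 4"
  by (cases rule: four_low_shape.cases, assumption)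
    (auto simp: low_vertices_shapes, auto simp: path4_def star4_def spider_def mustache_def)

text \<open>The three-leaf star is a case of its own: it has only three
  vertices of degree 1 or 2, but its centre can be the fourth point of \<open>M\<close>.\<close>

lemma tree_shapes:
  assumes "grown_tree V E" "card (low_vertices (V, E)) \<le> 4"
  shows "card V \<le> 3 \<or> (\<exists>s a b c. star3 (V, E) s a b c) \<or> four_low_shape (V, E)"
proof -
  have "(\<exists>a. V = {a} \<and> E = {}) \<or> (\<exists>a b. a \<noteq> b \<and> V = {a, b} \<and> E = {{a, b}}) \<or>
    (\<exists>a b c. distinct [a, b, c] \<and> V = {a, b, c} \<and> E = {{a, b}, {b, c}}) \<or>
    (\<exists>s a b c. star3 (V, E) s a b c) \<or> four_low_shape (V, E)"
    (is "?one V E \<or> ?two V E \<or> ?three V E \<or> ?star V E \<or> _")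
    using assms
  proof (induction rule: grown_tree.induct)
    case (single x)
    then show ?case by blast
  next
    case (add_leaf V E y x)
    let ?V = "insert x V" and ?E = "insert {x, y} E"
    have le: "card (low_vertices (V, E)) + of_bool (degree (V, E) y \<noteq> 2) \<le> 4"
      using card_low_vertices_add_leaf[OF add_leaf.hyps(1-3)] add_leaf.prems by linarith
    then have "card (low_vertices (V, E)) \<le> 4" by simp
    from add_leaf.IH[OF this] consider "?one V E" | "?two V E" | "?three V E" | "?star V E"
      | "four_low_shape (V, E)" by blast
    then show ?case
    proof cases
      case 1
      then have "V = {y}" "E = {}" using add_leaf.hyps(2) by auto
      then have "?two ?V ?E" using add_leaf.hyps(3) by (intro exI[of _ x] exI[of _ y]) simp
      then show ?thesis by blast
    next
      case 2
      then obtain a b where ab: "a \<noteq> b" "V = {a, b}" "E = {{a, b}}" by blast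
      then obtain z where z: "y \<noteq> z" "V = {y, z}" "E = {{y, z}}"
        using add_leaf.hyps(2) by (metis insert_commute insert_iff singletonD)
      then have "?three ?V ?E" using add_leaf.hyps(3)
        by (intro exI[of _ x] exI[of _ y] exI[of _ z]) simp
      then show ?thesis by blast
    next
      case 3
      then obtain a b c where abc: "distinct [a, b, c]" "V = {a, b, c}" "E = {{a, b}, {b, c}}"
        by blast
      consider "y = a" | "y = b" | "y = c" using add_leaf.hyps(2) abc(2) by blast
      then show ?thesis
      proof cases
        case 1
        then have "path4 (?V, ?E) x a b c" using abc add_leaf.hyps(3) by (auto simp: path4_def)
        then show ?thesis by (blast intro: four_low_shape.intros)
      next
        case 2
        then have "star3 (?V, ?E) b a c x" using abc add_leaf.hyps(3) by (auto simp: star3_def)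
        then show ?thesis by blast
      next
        case 3
        then have "path4 (?V, ?E) x c b a" using abc add_leaf.hyps(3) by (auto simp: path4_def)
        then show ?thesis by (blast intro: four_low_shape.intros)
      qed
    next
      case 4
      then obtain s a b c where st: "distinct [s, a, b, c]" "V = {s, a, b, c}"
          "E = {{s, a}, {s, b}, {s, c}}" by (auto simp: star3_def)
      consider "y = s" | "y = a" | "y = b" | "y = c" using add_leaf.hyps(2) st(2) by blast
      then have "four_low_shape (?V, ?E)"
      proof cases
        case 1
        then have "star4 (?V, ?E) s a b c x" using st add_leaf.hyps(3) by (auto simp: star4_def)
        then show ?thesis by (rule four_low_shape.intros)
      next
        case 2
        then have "spider (?V, ?E) s b c a x" using st add_leaf.hyps(3) by (auto simp: spider_def)
        then show ?thesis by (rule four_low_shape.intros)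
      next
        case 3
        then have "spider (?V, ?E) s a c b x" using st add_leaf.hyps(3) by (auto simp: spider_def)
        then show ?thesis by (rule four_low_shape.intros)
      next
        case 4
        then have "spider (?V, ?E) s a b c x" using st add_leaf.hyps(3) by (auto simp: spider_def)
        then show ?thesis by (rule four_low_shape.intros)
      qed
      then show ?thesis by blast
    next
      case 5
      \<comment> \<open>There are already four vertices of degree 1 or 2, so the new leaf must hang at a vertex
        of degree 2.\<close>
      then have deg: "degree (V, E) y = 2" using le card_low_vertices_four by fastforce
      from 5 have "four_low_shape (?V, ?E)"
      proof (cases rule: four_low_shape.cases)
        case (1 a b c e)
        then consider "y = b" | "y = c" using degree_eq_2_shapes(1) deg add_leaf.hyps(2) by fastforce
        then show ?thesis
        proof cases
          case b: 1
          have "spider (?V, ?E) b a x c e" using 1 b add_leaf.hyps(3)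
            by (auto simp: spider_def path4_def)
          then show ?thesis by (rule four_low_shape.intros)
        next
          case c: 2
          have "spider (?V, ?E) c e x b a" using 1 c add_leaf.hyps(3)
            by (auto simp: spider_def path4_def)
          then show ?thesis by (rule four_low_shape.intros)
        qed
      next
        case (2 s a b c e)
        then show ?thesis using degree_eq_2_shapes(2) deg add_leaf.hyps(2) by fastforce
      next
        case (3 s a b c e)
        then have "y = c" using degree_eq_2_shapes(3) deg add_leaf.hyps(2) by fastforce
        then have "mustache (?V, ?E) a b e x s c" using 3 add_leaf.hyps(3)
          by (auto simp: spider_def mustache_def mustache_edges_def)
        then show ?thesis by (rule four_low_shape.intros)
      next
        case (4 a b c e v w)
        then show ?thesis using degree_eq_2_shapes(4) deg add_leaf.hyps(2) by fastforce
      qed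
      then show ?thesis by blast
    qed
  qed
  then show ?thesis by (auto simp: card_insert_if)
qed

section \<open>Reduced trees as contractions of mustache trees\<close>

lemma edge_contraction_star3:
  assumes "star3 G a b c e" "distinct [a, b, c, e, v, w]"
  shows "edge_contraction {a, b, c, e} ({a, b, c, e, v, w}, mustache_edges a b c e v w)
    {{v, a}, {v, w}} (id(v := a, w := a)) G"
proof -
  let ?f = "id(v := a, w := a)"
  have E: "mustache_edges a b c e v w - {{v, a}, {v, w}} = {{v, b}, {w, c}, {w, e}}"
    using assms(2) by (auto simp: mustache_edges_def doubleton_eq_iff)
  have G: "G = ({a, b, c, e}, {{a, b}, {a, c}, {a, e}})" and dist: "distinct [a, b, c, e]"
    using assms(1) by (simp_all add: star3_def)
  have "bij_betw ((`) ?f) {{v, b}, {w, c}, {w, e}}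
      {{a, b}, {a, c}, {a, e}}"
    using assms(2) dist by (auto simp: bij_betw_def inj_on_def doubleton_eq_iff)
  moreover have "?f ` {a, b, c, e, v, w} = {a, b, c, e}" using assms(2) by auto
  moreover have "\<forall>x y. {x, y} \<in> {{v, a}, {v, w}} \<longrightarrow> ?f x = ?f y"
    using assms(2) by (auto simp: doubleton_eq_iff)
  moreover have "\<forall>x\<in>{a, b, c, e, v, w}. \<forall>y\<in>{a, b, c, e, v, w}. ?f x = ?f y \<longrightarrow>
      x = y \<or> {x, y} \<in> {{v, a}, {v, w}} \<or>
      (\<exists>z. {x, z} \<in> {{v, a}, {v, w}} \<and> {z, y} \<in> {{v, a}, {v, w}})"
    using assms(2) dist by (auto simp: doubleton_eq_iff)
  moreover have "\<forall>x\<in>{a, b, c, e}. ?f x = x" using assms(2) by auto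
  moreover have "{{v, a}, {v, w}} \<subseteq> mustache_edges a b c e v w" by (simp add: mustache_edges_def)
  ultimately show ?thesis unfolding edge_contraction_def G fst_conv snd_conv E by blast
qed

lemma edge_contraction_path4:
  assumes "path4 G a b c e" "distinct [a, b, c, e, v, w]"
  shows "edge_contraction {a, b, c, e} ({a, b, c, e, v, w}, mustache_edges a b c e v w)
    {{v, b}, {w, c}} (id(v := b, w := c)) G"
proof -
  let ?f = "id(v := b, w := c)"
  have E: "mustache_edges a b c e v w - {{v, b}, {w, c}} = {{v, a}, {v, w}, {w, e}}"
    using assms(2) by (auto simp: mustache_edges_def doubleton_eq_iff)
  have G: "G = ({a, b, c, e}, {{a, b}, {b, c}, {c, e}})" and dist: "distinct [a, b, c, e]"
    using assms(1) by (simp_all add: path4_def)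
  have "bij_betw ((`) ?f) {{v, a}, {v, w}, {w, e}}
      {{a, b}, {b, c}, {c, e}}"
    using assms(2) dist by (auto simp: bij_betw_def inj_on_def doubleton_eq_iff)
  moreover have "?f ` {a, b, c, e, v, w} = {a, b, c, e}" using assms(2) by auto
  moreover have "\<forall>x y. {x, y} \<in> {{v, b}, {w, c}} \<longrightarrow> ?f x = ?f y"
    using assms(2) by (auto simp: doubleton_eq_iff)
  moreover have "\<forall>x\<in>{a, b, c, e, v, w}. \<forall>y\<in>{a, b, c, e, v, w}. ?f x = ?f y \<longrightarrow>
      x = y \<or> {x, y} \<in> {{v, b}, {w, c}} \<or>
      (\<exists>z. {x, z} \<in> {{v, b}, {w, c}} \<and> {z, y} \<in> {{v, b}, {w, c}})"
    using assms(2) dist by (auto simp: doubleton_eq_iff)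
  moreover have "\<forall>x\<in>{a, b, c, e}. ?f x = x" using assms(2) by auto
  moreover have "{{v, b}, {w, c}} \<subseteq> mustache_edges a b c e v w" by (simp add: mustache_edges_def)
  ultimately show ?thesis unfolding edge_contraction_def G fst_conv snd_conv E by blast
qed

lemma edge_contraction_star4:
  assumes "star4 G s a b c e" "distinct [a, b, c, e, v, w]"
  shows "edge_contraction {a, b, c, e} ({a, b, c, e, v, w}, mustache_edges a b c e v w)
    {{v, w}} (id(v := s, w := s)) G"
proof -
  let ?f = "id(v := s, w := s)"
  have E: "mustache_edges a b c e v w - {{v, w}} = {{v, a}, {v, b}, {w, c}, {w, e}}"
    using assms(2) by (auto simp: mustache_edges_def doubleton_eq_iff)
  have G: "G = ({s, a, b, c, e}, {{s, a}, {s, b}, {s, c}, {s, e}})" and dist: "distinct [s, a, b, c, e]"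
    using assms(1) by (simp_all add: star4_def)
  have "bij_betw ((`) ?f) {{v, a}, {v, b}, {w, c}, {w, e}}
      {{s, a}, {s, b}, {s, c}, {s, e}}"
    using assms(2) dist by (auto simp: bij_betw_def inj_on_def doubleton_eq_iff)
  moreover have "?f ` {a, b, c, e, v, w} = {s, a, b, c, e}" using assms(2) by auto
  moreover have "\<forall>x y. {x, y} \<in> {{v, w}} \<longrightarrow> ?f x = ?f y"
    using assms(2) by (auto simp: doubleton_eq_iff)
  moreover have "\<forall>x\<in>{a, b, c, e, v, w}. \<forall>y\<in>{a, b, c, e, v, w}. ?f x = ?f y \<longrightarrow>
      x = y \<or> {x, y} \<in> {{v, w}} \<or>
      (\<exists>z. {x, z} \<in> {{v, w}} \<and> {z, y} \<in> {{v, w}})"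
    using assms(2) dist by (auto simp: doubleton_eq_iff)
  moreover have "\<forall>x\<in>{a, b, c, e}. ?f x = x" using assms(2) by auto
  moreover have "{{v, w}} \<subseteq> mustache_edges a b c e v w" by (simp add: mustache_edges_def)
  ultimately show ?thesis unfolding edge_contraction_def G fst_conv snd_conv E by blast
qed

lemma edge_contraction_spider:
  assumes "spider G s a b c e" "distinct [a, b, c, e, v, w]"
  shows "edge_contraction {a, b, c, e} ({a, b, c, e, v, w}, mustache_edges a b c e v w)
    {{w, c}} (id(v := s, w := c)) G"
proof -
  let ?f = "id(v := s, w := c)"
  have E: "mustache_edges a b c e v w - {{w, c}} = {{v, a}, {v, b}, {v, w}, {w, e}}"
    using assms(2) by (auto simp: mustache_edges_def doubleton_eq_iff)
  have G: "G = ({s, a, b, c, e}, {{s, a}, {s, b}, {s, c}, {c, e}})" and dist: "distinct [s, a, b, c, e]"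
    using assms(1) by (simp_all add: spider_def)
  have "bij_betw ((`) ?f) {{v, a}, {v, b}, {v, w}, {w, e}}
      {{s, a}, {s, b}, {s, c}, {c, e}}"
    using assms(2) dist by (auto simp: bij_betw_def inj_on_def doubleton_eq_iff)
  moreover have "?f ` {a, b, c, e, v, w} = {s, a, b, c, e}" using assms(2) by auto
  moreover have "\<forall>x y. {x, y} \<in> {{w, c}} \<longrightarrow> ?f x = ?f y"
    using assms(2) by (auto simp: doubleton_eq_iff)
  moreover have "\<forall>x\<in>{a, b, c, e, v, w}. \<forall>y\<in>{a, b, c, e, v, w}. ?f x = ?f y \<longrightarrow>
      x = y \<or> {x, y} \<in> {{w, c}} \<or>
      (\<exists>z. {x, z} \<in> {{w, c}} \<and> {z, y} \<in> {{w, c}})"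
    using assms(2) dist by (auto simp: doubleton_eq_iff)
  moreover have "\<forall>x\<in>{a, b, c, e}. ?f x = x" using assms(2) by auto
  moreover have "{{w, c}} \<subseteq> mustache_edges a b c e v w" by (simp add: mustache_edges_def)
  ultimately show ?thesis unfolding edge_contraction_def G fst_conv snd_conv E by blast
qed

lemma edge_contraction_refl: "edge_contraction M G {} id G"
  by (auto simp: edge_contraction_def bij_betw_def inj_on_def)

lemma reduced_tree_is_contracted_mustache:
  fixes M :: "'a::infinite set"
  assumes R: "reduced_tree M G" and M: "card M = 4" "M \<subseteq> verts G"
  obtains a b c e v w C f where "M = {a, b, c, e}" "distinct [a, b, c, e, v, w]"
    "edge_contraction M ({a, b, c, e, v, w}, mustache_edges a b c e v w) C f G"
proof -
  obtain V E where G: "G = (V, E)" by (cases G)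
  have "verts G \<noteq> {}" using M by auto
  then have grown: "grown_tree V E" using tree_is_grown[of G] R by (simp add: reduced_tree_def G)
  have finV: "finite V" using finite_graph_grown_tree[OF grown] by (simp add: finite_graph_def)
  have low: "low_vertices G \<subseteq> M" using R by (auto simp: low_vertices_def reduced_tree_def)
  have finM: "finite M" using M(1) card.infinite by fastforce
  then have "card (low_vertices G) \<le> 4" using low M(1) card_mono by metis
  moreover have "\<not> card V \<le> 3" using card_mono[OF finV, of M] M by (simp add: G)
  ultimately consider s a b c where "star3 G s a b c" | "four_low_shape G"
    using tree_shapes[OF grown] by (auto simp: G)
  then show ?thesis
  proof cases
    case (1 s a b c)
    then have "verts G = {s, a, b, c}" "distinct [s, a, b, c]" by (auto simp: star3_def)
    moreover from this have "M = verts G" using M by (intro card_subset_eq) auto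
    ultimately have Meq: "M = {s, a, b, c}" and d: "distinct [s, a, b, c]" by auto
    obtain v where v: "v \<notin> M" using ex_new_if_finite[OF infinite_UNIV finM] ..
    obtain w where w: "w \<notin> insert v M"
      using ex_new_if_finite[OF infinite_UNIV, of "insert v M"] finM by auto
    have "distinct [s, a, b, c, v, w]" using d v w by (auto simp: Meq)
    from that[OF Meq this] edge_contraction_star3[OF 1 this] show ?thesis by (simp add: Meq)
  next
    case 2
    have "low_vertices G = M"
      using low card_low_vertices_four[OF 2] M(1) finM by (intro card_subset_eq) auto
    note Mlow = this[symmetric]
    obtain v where v: "v \<notin> M" using ex_new_if_finite[OF infinite_UNIV finM] ..
    obtain w where w: "w \<notin> insert v M"
      using ex_new_if_finite[OF infinite_UNIV, of "insert v M"] finM by auto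
    from 2 show ?thesis
    proof (cases rule: four_low_shape.cases)
      case (1 a b c e)
      have Meq: "M = {a, b, c, e}" using low_vertices_shapes(2)[OF 1] Mlow by simp
      have "distinct [a, b, c, e, v, w]" using 1 v w by (auto simp: Meq path4_def)
      from that[OF Meq this] edge_contraction_path4[OF 1 this] show ?thesis by (simp add: Meq)
    next
      case (2 s a b c e)
      have Meq: "M = {a, b, c, e}" using low_vertices_shapes(3)[OF 2] Mlow by simp
      have "distinct [a, b, c, e, v, w]" using 2 v w by (auto simp: Meq star4_def)
      from that[OF Meq this] edge_contraction_star4[OF 2 this] show ?thesis by (simp add: Meq)
    next
      case (3 s a b c e)
      have Meq: "M = {a, b, c, e}" using low_vertices_shapes(4)[OF 3] Mlow by simp
      have "distinct [a, b, c, e, v, w]" using 3 v w by (auto simp: Meq spider_def)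
      from that[OF Meq this] edge_contraction_spider[OF 3 this] show ?thesis by (simp add: Meq)
    next
      case (4 a b c e v w)
      have Meq: "M = {a, b, c, e}" using low_vertices_shapes(5)[OF 4] Mlow by simp
      from 4 have "distinct [a, b, c, e, v, w]" "G = ({a, b, c, e, v, w}, mustache_edges a b c e v w)"
        by (auto simp: mustache_def)
      then show ?thesis using that[OF Meq] edge_contraction_refl[of M G] by metis
    qed
  qed
qed

lemma distinct4_iff_card: "distinct [a, b, c, e] \<longleftrightarrow> card {a, b, c, e} = 4"
proof -
  have "distinct xs \<longleftrightarrow> card (set xs) = length xs" for xs :: "'a list"
    using card_distinct distinct_card by blast
  from this[of "[a, b, c, e]"] show ?thesis
    by (simp only: list.set list.size) (simp add: eval_nat_numeral)
qed

lemma matching_sums_cong_set: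
  assumes "pseudo_metric_on {a, b, c, e} d" "distinct [a, b, c, e]"
    "{a', b', c', e'} = {a, b, c, e}"
  shows "matching_sums d a' b' c' e' = matching_sums d a b c e"
proof -
  have dist': "distinct [a', b', c', e']"
    using assms(2) unfolding distinct4_iff_card assms(3) .
  have "d x y = d y x" if "x \<in> {a, b, c, e}" "y \<in> {a, b, c, e}" for x y
    using assms(1) that unfolding pseudo_metric_on_def by blast
  then have sym: "d b a = d a b" "d c a = d a c" "d e a = d a e" "d c b = d b c" "d e b = d b e"
      "d e c = d c e" by auto
  have "a' \<in> {a, b, c, e}" "b' \<in> {a, b, c, e}" "c' \<in> {a, b, c, e}" "e' \<in> {a, b, c, e}"
    using assms(3) by blast+
  then show ?thesis using dist'
    by (elim insertE emptyE; simp add: matching_sums_def sym insert_commute add.commute)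
qed

section \<open>Minimal fillings\<close>

lemma minimal_filling_iff:
  fixes M :: "'a::infinite set"
  assumes M: "M = {a, b, c, e}" and dist: "distinct [a, b, c, e]" and pm: "pseudo_metric_on M \<rho>"
  shows "minimal_filling M \<rho> G \<omega> \<longleftrightarrow>
    filling M \<rho> G \<omega> \<and> 2 * graph_weight G \<omega> = min_max_sum \<rho> a b c e"
proof -
  have ge: "min_max_sum \<rho> a b c e \<le> 2 * graph_weight H \<eta>" if "filling M \<rho> H \<eta>" for H \<eta>
    using filling_weight_ge that by (simp add: M)
  have ex: "\<exists>H \<eta>. filling M \<rho> H \<eta> \<and> 2 * graph_weight H \<eta> = min_max_sum \<rho> a b c e"
  proof -
    have "Min (matching_sums \<rho> a b c e) \<in> matching_sums \<rho> a b c e"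
      by (rule Min_in) (simp_all add: matching_sums_def)
    then obtain a' b' c' e' where p: "{a', b', c', e'} = {a, b, c, e}" "distinct [a', b', c', e']"
      "Min (matching_sums \<rho> a b c e) = \<rho> a' b' + \<rho> c' e'"
    proof -
      assume *: "\<And>a' b' c' e'. {a', b', c', e'} = {a, b, c, e} \<Longrightarrow> distinct [a', b', c', e'] \<Longrightarrow>
        Min (matching_sums \<rho> a b c e) = \<rho> a' b' + \<rho> c' e' \<Longrightarrow> thesis"
      assume "Min (matching_sums \<rho> a b c e) \<in> matching_sums \<rho> a b c e"
      then show thesis using *[of a b c e] *[of a c b e] *[of a e b c] dist
        unfolding matching_sums_def by (auto simp: insert_commute)
    qed
    have eq: "matching_sums \<rho> a' b' c' e' = matching_sums \<rho> a b c e"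
      using matching_sums_cong_set[OF pm[unfolded M] dist p(1)] .
    obtain v where v: "v \<notin> M" using ex_new_if_finite[OF infinite_UNIV, of M] M by auto
    obtain w where w: "w \<notin> insert v M"
      using ex_new_if_finite[OF infinite_UNIV, of "insert v M"] M by auto
    have "v \<notin> {a', b', c', e'}" "w \<notin> insert v {a', b', c', e'}" using v w unfolding M p(1) by auto
    then have "distinct [a', b', c', e', v, w]" using p(2) by auto
    from optimal_mustache_filling[OF this, of \<rho>] pm p(3) show ?thesis unfolding M p(1) eq by blast
  qed
  show ?thesis
  proof
    assume mf: "minimal_filling M \<rho> G \<omega>"
    obtain H \<eta> where "filling M \<rho> H \<eta>" "2 * graph_weight H \<eta> = min_max_sum \<rho> a b c e"
      using ex by blast
    moreover from this(1) have "graph_weight G \<omega> \<le> graph_weight H \<eta>"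
      using mf unfolding minimal_filling_def by blast
    moreover have F: "filling M \<rho> G \<omega>" using mf by (simp add: minimal_filling_def)
    ultimately show "filling M \<rho> G \<omega> \<and> 2 * graph_weight G \<omega> = min_max_sum \<rho> a b c e"
      using ge[OF F] by linarith
  next
    assume r: "filling M \<rho> G \<omega> \<and> 2 * graph_weight G \<omega> = min_max_sum \<rho> a b c e"
    have "graph_weight G \<omega> \<le> graph_weight H \<eta>" if "filling M \<rho> H \<eta>" for H \<eta>
      using ge[OF that] r by linarith
    with r show "minimal_filling M \<rho> G \<omega>" by (simp add: minimal_filling_def)
  qed
qed

theorem mainTheorem14:
  fixes p :: "nat \<Rightarrow> 'a::infinite" and \<rho> :: "'a \<Rightarrow> 'a \<Rightarrow> real"
    and M :: "'a set" and S :: "real set"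
  assumes "inj_on p {1, 2, 3, 4}" and "M = {p 1, p 2, p 3, p 4}"
    and "pseudo_metric_on M \<rho>"
    and "S = {\<rho> (p 1) (p 2) + \<rho> (p 3) (p 4),
              \<rho> (p 1) (p 3) + \<rho> (p 2) (p 4),
              \<rho> (p 1) (p 4) + \<rho> (p 2) (p 3)}"
  shows "(\<forall>G \<omega>. minimal_filling M \<rho> G \<omega> \<longrightarrow> graph_weight G \<omega> = 1 / 2 * (Min S + Max S)) \<and>
    (\<forall>i j r s. {i, j, r, s} = {1, 2, 3, 4} \<and> Min S = \<rho> (p i) (p j) + \<rho> (p r) (p s) \<longrightarrow>
      (\<exists>G \<omega>. minimal_filling M \<rho> G \<omega> \<and> mustache_tree M (p i) (p j) (p r) (p s) G)) \<and>
    (\<forall>G \<omega>. minimal_filling M \<rho> G \<omega> \<and> reduced_tree M G \<longrightarrow>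
      (\<exists>i j r s T \<eta>. {i, j, r, s} = {1, 2, 3, 4} \<and>
        Min S = \<rho> (p i) (p j) + \<rho> (p r) (p s) \<and>
        minimal_filling M \<rho> T \<eta> \<and> mustache_tree M (p i) (p j) (p r) (p s) T \<and>
        zero_contraction M T \<eta> G \<omega>))"
proof -
  note M = assms(2)
  have Mp: "M = p ` {1, 2, 3, 4}" using M by simp
  have cardM: "card M = 4" using card_image[OF assms(1)] by (simp add: Mp)
  have dist: "distinct [p 1, p 2, p 3, p 4]"
    using assms(1) by (auto simp: inj_on_def)
  have S: "S = matching_sums \<rho> (p 1) (p 2) (p 3) (p 4)"
    using assms(4) by (simp add: matching_sums_def)
  note minimal_iff = minimal_filling_iff[OF M dist assms(3), folded S]
  have sums: "matching_sums \<rho> a b c e = S" if "M = {a, b, c, e}" for a b c e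
    using matching_sums_cong_set[OF assms(3)[unfolded M] dist trans[OF that[symmetric] M]] S by simp
  have dist4: "distinct [a, b, c, e]" if "M = {a, b, c, e}" for a b c e
    using cardM unfolding distinct4_iff_card that .
  have weight: "graph_weight G \<omega> = 1 / 2 * (Min S + Max S)" if "minimal_filling M \<rho> G \<omega>" for G \<omega>
    using that by (simp add: minimal_iff)
  have existence: "\<exists>G \<omega>. minimal_filling M \<rho> G \<omega> \<and> mustache_tree M (p i) (p j) (p r) (p s) G"
    if ijrs: "{i, j, r, s} = {1, 2, 3, 4}" and min: "Min S = \<rho> (p i) (p j) + \<rho> (p r) (p s)"
    for i j r s
  proof -
    have M': "M = {p i, p j, p r, p s}" unfolding Mp ijrs[symmetric] by simp
    obtain v where v: "v \<notin> M" using ex_new_if_finite[OF infinite_UNIV, of M] M by auto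
    obtain w where w: "w \<notin> insert v M"
      using ex_new_if_finite[OF infinite_UNIV, of "insert v M"] M by auto
    let ?G = "({p i, p j, p r, p s, v, w}, mustache_edges (p i) (p j) (p r) (p s) v w)"
    have "distinct [p i, p j, p r, p s, v, w]" using dist4[OF M'] v w unfolding M' by auto
    from optimal_mustache_filling[OF this, of \<rho>]
    obtain \<omega> where "filling M \<rho> ?G \<omega>" "2 * graph_weight ?G \<omega> = Min S + Max S"
      using assms(3) min sums[OF M'] M' by auto
    then have "minimal_filling M \<rho> ?G \<omega>" by (simp add: minimal_iff)
    moreover have "mustache_tree M (p i) (p j) (p r) (p s) ?G"
      unfolding mustache_tree_eq using v w M' by (intro exI[of _ v] exI[of _ w]) auto
    ultimately show ?thesis by blast
  qed
  have types: "\<exists>i j r s T \<eta>. {i, j, r, s} = {1, 2, 3, 4} \<and>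
      Min S = \<rho> (p i) (p j) + \<rho> (p r) (p s) \<and>
      minimal_filling M \<rho> T \<eta> \<and> mustache_tree M (p i) (p j) (p r) (p s) T \<and>
      zero_contraction M T \<eta> G \<omega>"
    if mf: "minimal_filling M \<rho> G \<omega>" and red: "reduced_tree M G" for G \<omega>
  proof -
    have F: "filling M \<rho> G \<omega>" and W: "2 * graph_weight G \<omega> = Min S + Max S"
      using mf by (auto simp: minimal_iff)
    have "M \<subseteq> verts G" using F by (auto simp: filling_def joins_def)
    then obtain a b c e v w C f where M': "M = {a, b, c, e}" and d: "distinct [a, b, c, e, v, w]"
      and con: "edge_contraction M ({a, b, c, e, v, w}, mustache_edges a b c e v w) C f G"
      using reduced_tree_is_contracted_mustache[OF red cardM] by metis
    let ?T = "({a, b, c, e, v, w}, mustache_edges a b c e v w)"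
    obtain \<eta> where \<eta>: "filling M \<rho> ?T \<eta>" "zero_contraction M ?T \<eta> G \<omega>"
        "graph_weight ?T \<eta> = graph_weight G \<omega>"
      using filling_edge_expansion[OF F _ con] joins_mustache[OF d] M' by auto
    have W': "2 * graph_weight ?T \<eta> = min_max_sum \<rho> a b c e"
      unfolding sums[OF M'] using \<eta>(3) W by simp
    have min: "Min S = \<rho> a b + \<rho> c e"
      using mustache_filling_min[OF \<eta>(1)[unfolded M'] d W'] sums[OF M'] by simp
    have "minimal_filling M \<rho> ?T \<eta>" using \<eta>(1,3) W by (simp add: minimal_iff)
    moreover have "mustache_tree M a b c e ?T"
      unfolding mustache_tree_eq using d M' by (intro exI[of _ v] exI[of _ w]) auto
    moreover have "a \<in> p ` {1, 2, 3, 4}" "b \<in> p ` {1, 2, 3, 4}" "c \<in> p ` {1, 2, 3, 4}"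
        "e \<in> p ` {1, 2, 3, 4}" using M' unfolding Mp by blast+
    then obtain i j r s where i: "i \<in> {1, 2, 3, 4}" "j \<in> {1, 2, 3, 4}" "r \<in> {1, 2, 3, 4}"
        "s \<in> {1, 2, 3, 4}" "a = p i" "b = p j" "c = p r" "e = p s" by blast
    moreover have "{i, j, r, s} = {1, 2, 3, 4}"
    proof (rule card_subset_eq)
      have "distinct [i, j, r, s]" using d i(5-8) by auto
      then have "card {i, j, r, s} = 4" by simp
      then show "card {i, j, r, s} = card {1, 2, 3, 4 :: nat}" by simp
    qed (use i in auto)
    ultimately show ?thesis using min \<eta>(2) by blast
  qed
  show ?thesis
  proof (intro conjI allI impI)
    fix G \<omega> assume "minimal_filling M \<rho> G \<omega>"
    then show "graph_weight G \<omega> = 1 / 2 * (Min S + Max S)" by (rule weight)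
  qed (elim conjE, rule existence types; assumption)+
qed

end
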